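(* Let $\theta$ be an inner function in $\mathbb{D}$ and let $\zeta\in AC(\theta)\cap\sigma(\theta)$. Then there exists a sequence $\{\lambda_n\}\subset\mathbb{D}$ with $\lambda_n\to\zeta$ such that $\{\widetilde{k}_{\lambda_n}\}$ is UMNR in $K_\theta$.
   Context: $\mathbb{D}$ is the open unit disc, $\mathbb{T}$ the unit circle, $H^2=H^2(\mathbb{D})$ the Hardy space. For an inner function $\theta$ in $\mathbb{D}$, the model space is $K_\theta=H^2\ominus\theta H^2$; for $\lambda\in\mathbb{D}$, $k_\lambda(z)=\frac{1-\overline{\theta(\lambda)}\theta(z)}{1-\overline{\lambda}z}$ is the reproducing kernel of $K_\theta$ at $\lambda$, and $\widetilde{k}_\lambda=k_\lambda/\|k_\lambda\|_2$. Boundary spectrum: $\sigma(\theta)=\{\zeta\in\mathbb{T}:\liminf_{z\to\zeta,\,z\in\mathbb{D}}|\theta(z)|=0\}$. Ahern--Clark set: let $z_j$ be the zeros of $\theta$ (counting multiplicities) and $\nu$ the positive singular measure on $\mathbb{T}$ generating the singular inner factor of $\theta$. Then $AC(\theta)=\Big\{\zeta\in\mathbb{T}:\ \sum_j\frac{1-|z_j|^2}{|\zeta-z_j|^2}+\int_{\mathbb{T}}\frac{d\nu(z)}{|\zeta-z|^2}<\infty\Big\}$. Sequences are infinite. A sequence of unit vectors $\{x_n\}$ in a Hilbert space is uniformly minimal if $\inf_n\operatorname{dist}(x_n,\overline{\operatorname{Lin}}\{x_m:m\ne n\})>0$ (equivalently, it has a biorthogonal system with uniformly bounded norms). A Riesz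 sequence is a sequence which is a Riesz basis of its closed linear span. A sequence of unit vectors is UMNR (uniformly minimal non-Riesz) if it is uniformly minimal and does not contain any subsequence which is a Riesz sequence. *)

theory Defs
  imports "HOL-Complex_Analysis.Complex_Analysis"
begin

text \<open>Measures on the unit circle are Borel measures on the plane that vanish off the circle;
  \<open>circle_measure\<close> is arc length normalized to total mass 1.\<close>

definition circle_measure :: "complex measure" where
  "circle_measure = distr (uniform_measure lborel {0..<2 * pi}) borel cis"

text \<open>An element of the Hardy space is a holomorphic function on the open unit disc; it is
  represented by the total function that vanishes off the disc, so that equality in the Hardy
  space is equality of functions and \<open>hardy_norm\<close> is a genuine norm.\<close>

definition hardy2 :: "(complex \<Rightarrow> complex) set" where
  "hardy2 = {f. f holomorphic_on ball 0 1 \<and> (\<forall>z. z \<notin> ball 0 1 \<longrightarrow> f z = 0) \<and>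
     bdd_above ((\<lambda>r. LINT \<xi>|circle_measure. (cmod (f (of_real r * \<xi>)))\<^sup>2) ` {0..<1})}"

text \<open>For members of \<open>hardy2\<close> the limit exists and equals the inner product, in
  the \<open>L\<close>-2 space of the circle, of the radial boundary values.\<close>

definition hardy_inner :: "(complex \<Rightarrow> complex) \<Rightarrow> (complex \<Rightarrow> complex) \<Rightarrow> complex" where
  "hardy_inner f g =
     Lim (at_left 1)
       (\<lambda>r::real. LINT \<xi>|circle_measure. f (of_real r * \<xi>) * cnj (g (of_real r * \<xi>)))"

definition hardy_norm :: "(complex \<Rightarrow> complex) \<Rightarrow> real" where
  "hardy_norm f = sqrt (Re (hardy_inner f f))"

definition lin_span :: "(complex \<Rightarrow> complex) set \<Rightarrow> (complex \<Rightarrow> complex) set" where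
  "lin_span S = {(\<lambda>z. \<Sum>f\<in>F. c f * f z) | F c. finite F \<and> F \<subseteq> S}"

definition closed_lin_span :: "(complex \<Rightarrow> complex) set \<Rightarrow> (complex \<Rightarrow> complex) set" where
  "closed_lin_span S =
     {g \<in> hardy2. \<forall>\<epsilon>>0. \<exists>h\<in>lin_span S. hardy_norm (\<lambda>z. g z - h z) < \<epsilon>}"

definition hardy_dist :: "(complex \<Rightarrow> complex) \<Rightarrow> (complex \<Rightarrow> complex) set \<Rightarrow> real" where
  "hardy_dist f S = (INF g\<in>S. hardy_norm (\<lambda>z. f z - g z))"

definition uniformly_minimal :: "(nat \<Rightarrow> complex \<Rightarrow> complex) \<Rightarrow> bool" where
  "uniformly_minimal x \<longleftrightarrow>
     (INF n. hardy_dist (x n) (closed_lin_span (x ` {m. m \<noteq> n}))) > 0"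

definition orthonormal_basis ::
    "(complex \<Rightarrow> complex) set \<Rightarrow> (nat \<Rightarrow> complex \<Rightarrow> complex) \<Rightarrow> bool" where
  "orthonormal_basis H e \<longleftrightarrow>
     (\<forall>n. e n \<in> H) \<and>
     (\<forall>m n. hardy_inner (e m) (e n) = (if m = n then 1 else 0)) \<and>
     H \<subseteq> closed_lin_span (range e)"

definition linear_isomorphism ::
    "(complex \<Rightarrow> complex) set \<Rightarrow> ((complex \<Rightarrow> complex) \<Rightarrow> complex \<Rightarrow> complex) \<Rightarrow> bool" where
  "linear_isomorphism H T \<longleftrightarrow>
     bij_betw T H H \<and>
     (\<forall>f\<in>H. \<forall>g\<in>H. T (\<lambda>z. f z + g z) = (\<lambda>z. T f z + T g z)) \<and>
     (\<forall>c. \<forall>f\<in>H. T (\<lambda>z. c * f z) = (\<lambda>z. c * T f z)) \<and>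
     (\<exists>C. \<forall>f\<in>H. hardy_norm (T f) \<le> C * hardy_norm f \<and> hardy_norm f \<le> C * hardy_norm (T f))"

text \<open>A Riesz basis of \<open>H\<close> is the image of an orthonormal basis of \<open>H\<close> under a bounded linear
  bijection of \<open>H\<close> with bounded inverse.\<close>

definition riesz_basis ::
    "(complex \<Rightarrow> complex) set \<Rightarrow> (nat \<Rightarrow> complex \<Rightarrow> complex) \<Rightarrow> bool" where
  "riesz_basis H x \<longleftrightarrow>
     (\<exists>e T. orthonormal_basis H e \<and> linear_isomorphism H T \<and> (\<forall>n. x n = T (e n)))"

definition riesz_sequence :: "(nat \<Rightarrow> complex \<Rightarrow> complex) \<Rightarrow> bool" where
  "riesz_sequence x \<longleftrightarrow> riesz_basis (closed_lin_span (range x)) x"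

definition UMNR_in ::
    "(complex \<Rightarrow> complex) set \<Rightarrow> (nat \<Rightarrow> complex \<Rightarrow> complex) \<Rightarrow> bool" where
  "UMNR_in K x \<longleftrightarrow>
     (\<forall>n. x n \<in> K \<and> hardy_norm (x n) = 1) \<and>
     uniformly_minimal x \<and>
     \<not> (\<exists>\<rho>. strict_mono \<rho> \<and> riesz_sequence (x \<circ> \<rho>))"

definition inner_function :: "(complex \<Rightarrow> complex) \<Rightarrow> bool" where
  "inner_function \<theta> \<longleftrightarrow>
     \<theta> holomorphic_on ball 0 1 \<and>
     (\<forall>z\<in>ball 0 1. cmod (\<theta> z) \<le> 1) \<and>
     (AE \<xi> in circle_measure.
        \<exists>w. cmod w = 1 \<and> ((\<lambda>r::real. \<theta> (of_real r * \<xi>)) \<longlongrightarrow> w) (at_left 1))"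

definition model_space :: "(complex \<Rightarrow> complex) \<Rightarrow> (complex \<Rightarrow> complex) set" where
  "model_space \<theta> = {f \<in> hardy2. \<forall>g\<in>hardy2. hardy_inner f (\<lambda>z. \<theta> z * g z) = 0}"

definition model_kernel :: "(complex \<Rightarrow> complex) \<Rightarrow> complex \<Rightarrow> complex \<Rightarrow> complex" where
  "model_kernel \<theta> w z =
     (if z \<in> ball 0 1 then (1 - cnj (\<theta> w) * \<theta> z) / (1 - cnj w * z) else 0)"

definition normalized_kernel :: "(complex \<Rightarrow> complex) \<Rightarrow> complex \<Rightarrow> complex \<Rightarrow> complex" where
  "normalized_kernel \<theta> w z = model_kernel \<theta> w z / of_real (hardy_norm (model_kernel \<theta> w))"

definition boundary_spectrum :: "(complex \<Rightarrow> complex) \<Rightarrow> complex set" where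
  "boundary_spectrum \<theta> =
     {\<zeta> \<in> sphere 0 1. Liminf (at \<zeta> within ball 0 1) (\<lambda>z. ereal (cmod (\<theta> z))) = 0}"

definition disc_zeros :: "(complex \<Rightarrow> complex) \<Rightarrow> complex set" where
  "disc_zeros \<theta> = {a \<in> ball 0 1. \<theta> a = 0}"

definition blaschke_factor :: "complex \<Rightarrow> complex \<Rightarrow> complex" where
  "blaschke_factor a z =
     (if a = 0 then z else of_real (cmod a) / a * ((a - z) / (1 - cnj a * z)))"

text \<open>The canonical factorization of an inner function: a unimodular constant \<open>c\<close>, the Blaschke
  product \<open>B\<close> over the zeros of \<open>\<theta>\<close> repeated according to multiplicity (\<open>zorder\<close>), and the
  singular inner function generated by \<open>\<nu>\<close>. For an inner \<open>\<theta>\<close> there is exactly one such \<open>\<nu>\<close>.\<close>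

definition generates_singular_factor :: "(complex \<Rightarrow> complex) \<Rightarrow> complex measure \<Rightarrow> bool" where
  "generates_singular_factor \<theta> \<nu> \<longleftrightarrow>
     sets \<nu> = sets borel \<and> finite_measure \<nu> \<and> emeasure \<nu> (- sphere 0 1) = 0 \<and>
     (\<exists>N\<in>sets borel. emeasure circle_measure N = 0 \<and> emeasure \<nu> (- N) = 0) \<and>
     (\<exists>c B. cmod c = 1 \<and>
        (\<forall>z\<in>ball 0 1.
           ((\<lambda>F. \<Prod>a\<in>F. blaschke_factor a z ^ nat (zorder \<theta> a)) \<longlongrightarrow> B z)
             (finite_subsets_at_top (disc_zeros \<theta>)) \<and>
           \<theta> z = c * B z * exp (- (LINT \<xi>|\<nu>. (\<xi> + z) / (\<xi> - z)))))"

text \<open>The division in the last integral is the one of \<open>ennreal\<close>, where \<open>1 / 0 = \<infinity>\<close>, so a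
  point mass of \<open>\<nu>\<close> at \<open>\<zeta>\<close> makes the integral infinite. (With real division \<open>1 / 0 = 0\<close>,
  and it would be ignored.)\<close>

definition ahern_clark :: "(complex \<Rightarrow> complex) \<Rightarrow> complex set" where
  "ahern_clark \<theta> =
     {\<zeta> \<in> sphere 0 1. \<exists>\<nu>. generates_singular_factor \<theta> \<nu> \<and>
        (\<integral>\<^sup>+ a. ennreal (of_int (zorder \<theta> a) * ((1 - (cmod a)\<^sup>2) / (cmod (\<zeta> - a))\<^sup>2))
           \<partial>count_space (disc_zeros \<theta>)) +
        (\<integral>\<^sup>+ \<xi>. 1 / ennreal ((cmod (\<zeta> - \<xi>))\<^sup>2) \<partial>\<nu>) < \<infinity>}"

end

theory Submission
  imports Defs
begin

text \<open>
  The reproducing kernel \<open>k\<^sub>w\<close> of the model space has squared norm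
  \<open>q w = (1 - |\<theta> w|\<^sup>2) / (1 - |w|\<^sup>2)\<close> (\<open>kernel_square\<close>). The Ahern--Clark condition keeps \<open>q\<close>
  bounded on the radius to \<open>\<zeta>\<close>, by the canonical factorization of \<open>\<theta>\<close>. As in the
  Julia--Caratheodory theorem, along suitable radial points \<open>q\<close> then tends to some \<open>L\<close> and \<open>\<theta>\<close>
  to some unimodular \<open>\<beta>\<close>, and all kernels \<open>k\<^sub>w\<close> of bounded norm tend weakly, as \<open>w \<rightarrow> \<zeta>\<close>, to the
  boundary kernel \<open>h w = (1 - cnj \<beta> * \<theta> w) / (1 - cnj \<zeta> * w)\<close>, whose squared norm is \<open>L\<close>.

  Since \<open>\<zeta>\<close> lies in the spectrum, \<open>q\<close> is also unbounded near \<open>\<zeta>\<close>, so by the intermediate value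
  theorem there are points \<open>w\<^sub>n \<rightarrow> \<zeta>\<close> with \<open>q (w\<^sub>n) = 2L\<close>. Their normalized kernels \<open>x\<^sub>n\<close> tend weakly to
  a vector \<open>g\<close> of squared norm \<open>1/2\<close>. Because of the common component \<open>g\<close>, the sum of the first \<open>N\<close>
  vectors of any subsequence has norm of order \<open>N\<close>, whereas it would be at most of order \<open>\<surd>N\<close> for a
  Riesz sequence. The
  remainders \<open>x\<^sub>n - g\<close> tend weakly to zero and have squared norms near \<open>1/2\<close>; on a sparse subsequence
  they are nearly orthogonal to each other and to \<open>g\<close>, and this gives uniform minimality.

  The proof never forms \<open>g\<close> or uses weak compactness: everything is read off the Gram matrix
  \<open>\<langle>x\<^sub>m, x\<^sub>n\<rangle>\<close>, whose entries are explicit (\<open>normalized_kernel_gram\<close>). The Hilbert space part is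
  \<open>UMNR_if_gram_nearly_constant\<close>; the function theory is in \<open>boundary_kernel_limit\<close>, which
  is the weak convergence above restricted to kernels, and in \<open>ahern_clark_radial_bound\<close>.
\<close>

section \<open>Arc length on the circle and Parseval's identity\<close>

definition disc_function :: "(complex \<Rightarrow> complex) \<Rightarrow> bool" where
  "disc_function f \<longleftrightarrow> f holomorphic_on ball 0 1 \<and> (\<forall>z. z \<notin> ball 0 1 \<longrightarrow> f z = 0)"

definition taylor_coeff :: "(complex \<Rightarrow> complex) \<Rightarrow> nat \<Rightarrow> complex" where
  "taylor_coeff f n = (deriv ^^ n) f 0 / fact n"

text \<open>The approximants whose limit for \<open>r \<rightarrow> 1\<close> is \<open>hardy_inner\<close>.\<close>

definition circle_pairing :: "real \<Rightarrow> (complex \<Rightarrow> complex) \<Rightarrow> (complex \<Rightarrow> complex) \<Rightarrow> complex" where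
  "circle_pairing r f g =
     (LINT \<xi>|circle_measure. f (of_real r * \<xi>) * cnj (g (of_real r * \<xi>)))"

lemma sets_circle_measure [simp, measurable_cong]: "sets circle_measure = sets borel"
  by (simp add: circle_measure_def)

lemma space_circle_measure [simp]: "space circle_measure = UNIV"
  by (simp add: circle_measure_def)

lemma cis_borel [measurable]: "cis \<in> borel_measurable borel"
  by (intro borel_measurable_continuous_onI continuous_intros)

lemma cnj_borel [measurable]: "cnj \<in> borel_measurable borel"
  by (intro borel_measurable_continuous_onI continuous_intros)

lemma emeasure_circle_measure_UNIV: "emeasure circle_measure UNIV = 1"
proof -
  have "emeasure (uniform_measure lborel {0..<2*pi}) UNIV = 1"
    by (subst emeasure_uniform_measure) (auto simp: emeasure_lborel_Ico ennreal_divide_self)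
  then show ?thesis
    unfolding circle_measure_def by (subst emeasure_distr) auto
qed

interpretation circle: finite_measure circle_measure
  by standard (simp add: emeasure_circle_measure_UNIV)

lemma measure_circle_measure_UNIV: "measure circle_measure UNIV = 1"
  by (simp add: measure_def emeasure_circle_measure_UNIV)

lemma AE_circle: "AE \<xi> in circle_measure. cmod \<xi> = 1"
  unfolding circle_measure_def by (subst AE_distr_iff) auto

lemma circle_integral_eq:
  fixes f :: "complex \<Rightarrow> complex"
  assumes [measurable]: "f \<in> borel_measurable borel"
  shows "(LINT \<xi>|circle_measure. f \<xi>) = (LINT t:{0..<2*pi}|lborel. f (cis t)) / of_real (2*pi)"
proof -
  have um: "uniform_measure lborel {0..<2*pi} =
      density lborel (\<lambda>t. ennreal (indicator {0..<2*pi} t / (2*pi)))"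
  proof -
    have "1 / ennreal (2*pi) = ennreal (1 / (2*pi))"
      using divide_ennreal[of 1 "2*pi"] by simp
    then show ?thesis
      unfolding uniform_measure_def
      by (intro density_cong) (auto split: split_indicator)
  qed
  have "(LINT \<xi>|circle_measure. f \<xi>) = (LINT t|uniform_measure lborel {0..<2*pi}. f (cis t))"
    unfolding circle_measure_def by (rule integral_distr) auto
  also have "\<dots> = (LINT t|lborel. (indicator {0..<2*pi} t / (2*pi)) *\<^sub>R f (cis t))"
    unfolding um by (subst integral_density) (auto split: split_indicator)
  also have "\<dots> = (LINT t|lborel. (1 / of_real (2*pi)) * (indicator {0..<2*pi} t *\<^sub>R f (cis t)))"
    by (intro Bochner_Integration.integral_cong) (auto simp: scaleR_conv_of_real split: split_indicator)
  also have "\<dots> = (LINT t:{0..<2*pi}|lborel. f (cis t)) / of_real (2*pi)"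
    unfolding set_lebesgue_integral_def by (subst integral_mult_right_zero) simp
  finally show ?thesis .
qed

lemma circle_monomials_orthonormal:
  "(LINT \<xi>|circle_measure. \<xi> ^ n * cnj (\<xi> ^ m)) = (if n = m then 1 else 0)"
proof -
  define k :: int where "k = int n - int m"
  have pw: "cis t ^ n * cnj (cis t ^ m) = cis (of_int k * t)" for t
  proof -
    have "cis t ^ n * cnj (cis t ^ m) = cis (real n * t) * cis (- (real m * t))"
      by (metis Complex.DeMoivre cis_cnj)
    then show ?thesis by (simp add: k_def cis_mult left_diff_distrib)
  qed
  have "(LINT \<xi>|circle_measure. \<xi> ^ n * cnj (\<xi> ^ m)) =
      (LINT t:{0..<2*pi}|lborel. cis (of_int k * t)) / of_real (2*pi)"
    by (subst circle_integral_eq) (auto simp: pw simp del: complex_cnj_power)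
  also have "(LINT t:{0..<2*pi}|lborel. cis (of_int k * t)) = (LINT t:{0..2*pi}|lborel. cis (of_int k * t))"
    using AE_lborel_singleton[of "2*pi"]
    by (intro set_integral_cong_set) (auto simp: set_borel_measurable_def)
  also have "\<dots> = integral {0..2*pi} (\<lambda>t. cis (of_int k * t))"
    by (intro set_borel_integral_eq_integral borel_integrable_atLeastAtMost' continuous_intros)
  also have "\<dots> = (if n = m then of_real (2*pi) else 0)"
  proof (cases "n = m")
    case True
    then show ?thesis by (simp add: k_def of_real_def)
  next
    case False
    then have k: "k \<noteq> 0" by (simp add: k_def)
    have "((\<lambda>t. cis (of_int k * t)) has_integral
        cis (of_int k * (2*pi)) / (\<i> * of_int k) - cis (of_int k * 0) / (\<i> * of_int k)) {0..2*pi}"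
    proof (rule fundamental_theorem_of_calculus)
      fix t :: real
      have "((\<lambda>t. exp (\<i> * of_int k * of_real t) / (\<i> * of_int k)) has_vector_derivative
          exp (\<i> * of_int k * of_real t)) (at t within {0..2*pi})"
        using k by (auto intro!: derivative_eq_intros has_vector_derivative_real_field)
      then show "((\<lambda>t. cis (of_int k * t) / (\<i> * of_int k)) has_vector_derivative
          cis (of_int k * t)) (at t within {0..2*pi})"
        by (simp add: cis_conv_exp mult_ac)
    qed simp
    moreover have "cis (of_int k * (2*pi)) = 1"
      using cis_multiple_2pi[of "of_int k"] by (simp add: mult_ac)
    ultimately show ?thesis using False by (simp add: integral_unique)
  qed
  finally show ?thesis by auto
qed

lemma disc_function_borel:
  assumes "disc_function f"
  shows "f \<in> borel_measurable borel"
proof -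
  have "(\<lambda>z. if z \<in> ball 0 1 then f z else 0) \<in> borel_measurable borel"
    using assms by (intro borel_measurable_continuous_on_if)
      (auto simp: disc_function_def intro: holomorphic_on_imp_continuous_on)
  moreover have "(\<lambda>z. if z \<in> ball 0 1 then f z else 0) = f"
    using assms by (auto simp: disc_function_def)
  ultimately show ?thesis by simp
qed

lemma of_real_mult_in_disc:
  "cmod \<xi> = 1 \<Longrightarrow> 0 \<le> r \<Longrightarrow> r < 1 \<Longrightarrow> of_real r * \<xi> \<in> ball 0 1"
  by (simp add: norm_mult)

lemma disc_function_bounded_on_circle:
  assumes "disc_function f" "0 \<le> r" "r < 1"
  obtains B where "0 \<le> B" "\<And>\<xi>. cmod \<xi> = 1 \<Longrightarrow> cmod (f (of_real r * \<xi>)) \<le> B"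
proof -
  have "compact (f ` cball 0 r)"
    using assms
    by (intro compact_continuous_image compact_cball holomorphic_on_imp_continuous_on)
      (auto simp: disc_function_def elim: holomorphic_on_subset)
  then obtain B where "\<forall>w\<in>f ` cball 0 r. cmod w \<le> B"
    by (meson bounded_iff compact_imp_bounded)
  then have "cmod (f (of_real r * \<xi>)) \<le> max B 0" if "cmod \<xi> = 1" for \<xi>
    using that assms by (intro max.coboundedI1) (auto simp: norm_mult)
  then show thesis
    using that[of "max B 0"] by simp
qed

lemma circle_integrable_bounded:
  fixes f :: "complex \<Rightarrow> complex"
  assumes "f \<in> borel_measurable borel" "\<And>\<xi>. cmod \<xi> = 1 \<Longrightarrow> cmod (f \<xi>) \<le> B"
  shows "integrable circle_measure f"
proof (rule circle.integrable_const_bound)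
  show "AE \<xi> in circle_measure. cmod (f \<xi>) \<le> B"
    using AE_circle by eventually_elim (rule assms)
  show "f \<in> borel_measurable circle_measure"
    using assms(1) by (simp cong: measurable_cong_sets)
qed

lemma circle_pairing_integrable:
  assumes "disc_function f" "disc_function g" "0 \<le> r" "r < 1"
  shows "integrable circle_measure (\<lambda>\<xi>. f (of_real r * \<xi>) * cnj (g (of_real r * \<xi>)))"
proof -
  obtain A where A: "0 \<le> A" "\<And>\<xi>. cmod \<xi> = 1 \<Longrightarrow> cmod (f (of_real r * \<xi>)) \<le> A"
    using disc_function_bounded_on_circle assms by blast
  obtain B where B: "0 \<le> B" "\<And>\<xi>. cmod \<xi> = 1 \<Longrightarrow> cmod (g (of_real r * \<xi>)) \<le> B"
    using disc_function_bounded_on_circle assms by blast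
  have [measurable]: "f \<in> borel_measurable borel" "g \<in> borel_measurable borel"
    using assms by (auto intro: disc_function_borel)
  show ?thesis
    using A B by (intro circle_integrable_bounded[of _ "A * B"]) (auto simp: norm_mult intro!: mult_mono)
qed

lemma taylor_sums:
  assumes "disc_function f" "z \<in> ball 0 1"
  shows "(\<lambda>n. taylor_coeff f n * z ^ n) sums f z"
  using holomorphic_power_series[of f 0 1 z] assms by (auto simp: disc_function_def taylor_coeff_def)

lemma powser_summable_norm:
  fixes a :: "nat \<Rightarrow> complex"
  assumes a: "\<And>z. z \<in> ball 0 1 \<Longrightarrow> (\<lambda>n. a n * z ^ n) sums f z" and r: "0 \<le> r" "r < 1"
  shows "summable (\<lambda>n. cmod (a n) * r ^ n)"
proof -
  define s where "s = (r + 1) / 2"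
  have s: "r < s" "s < 1" using r by (auto simp: s_def)
  have "summable (\<lambda>n. a n * (of_real s) ^ n)"
    using a[of "of_real s"] r s by (auto simp: sums_iff)
  then have "summable (\<lambda>n. norm (a n * (of_real r) ^ n))"
    by (rule powser_insidea) (use r s in auto)
  then show ?thesis using r by (simp add: norm_mult norm_power)
qed

text \<open>The power series of \<open>f\<close> converges absolutely and uniformly on the circle of radius \<open>r\<close>, so it can
  be integrated termwise.\<close>

lemma powser_circle_integral_sums:
  assumes "disc_function f" "0 \<le> r" "r < 1"
    and a: "\<And>z. z \<in> ball 0 1 \<Longrightarrow> (\<lambda>n. a n * z ^ n) sums f z"
    and h: "h \<in> borel_measurable borel" "\<And>\<xi>. cmod \<xi> = 1 \<Longrightarrow> cmod (h \<xi>) \<le> B"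
  shows "(\<lambda>n. a n * of_real r ^ n * (LINT \<xi>|circle_measure. \<xi> ^ n * h \<xi>)) sums
     (LINT \<xi>|circle_measure. f (of_real r * \<xi>) * h \<xi>)"
proof -
  define u where "u = (\<lambda>n \<xi>. a n * of_real r ^ n * (\<xi> ^ n * h \<xi>))"
  note [measurable] = h(1) disc_function_borel[OF assms(1)]
  have B: "0 \<le> B" using h(2)[of 1] norm_ge_zero[of "h 1"] by (simp del: norm_ge_zero)
  have bd: "cmod (u n \<xi>) \<le> cmod (a n) * r ^ n * B" if "cmod \<xi> = 1" for n \<xi>
    using h(2)[OF that] assms that by (auto simp: u_def norm_mult norm_power intro!: mult_left_mono)
  have int: "integrable circle_measure (u n)" for n
    by (rule circle_integrable_bounded[OF _ bd]) (auto simp: u_def)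
  have sm: "summable (\<lambda>n. cmod (a n) * r ^ n * B)"
    using powser_summable_norm[OF a assms(2,3)] by (rule summable_mult2)
  have AEs: "AE \<xi> in circle_measure. summable (\<lambda>n. norm (u n \<xi>))"
    using AE_circle
  proof eventually_elim
    case (elim \<xi>)
    show ?case
      by (rule summable_comparison_test'[OF sm, of 0]) (use bd elim in auto)
  qed
  have "(LINT \<xi>|circle_measure. norm (u n \<xi>)) \<le> cmod (a n) * r ^ n * B" for n
  proof -
    have "(LINT \<xi>|circle_measure. norm (u n \<xi>)) \<le> (LINT \<xi>|circle_measure. cmod (a n) * r ^ n * B)"
      using AE_circle by (intro integral_mono_AE integrable_norm int) (auto intro: bd)
    then show ?thesis by (simp add: measure_circle_measure_UNIV)
  qed
  then have "summable (\<lambda>n. LINT \<xi>|circle_measure. norm (u n \<xi>))"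
    by (intro summable_comparison_test'[OF sm, of 0]) auto
  from sums_integral[OF int AEs this]
  have "(\<lambda>n. LINT \<xi>|circle_measure. u n \<xi>) sums (LINT \<xi>|circle_measure. (\<Sum>n. u n \<xi>))" .
  moreover have "(LINT \<xi>|circle_measure. (\<Sum>n. u n \<xi>)) = (LINT \<xi>|circle_measure. f (of_real r * \<xi>) * h \<xi>)"
  proof (rule integral_cong_AE)
    show "AE \<xi> in circle_measure. (\<Sum>n. u n \<xi>) = f (of_real r * \<xi>) * h \<xi>"
      using AE_circle
    proof eventually_elim
      case (elim \<xi>)
      have "(\<lambda>n. a n * (of_real r * \<xi>) ^ n * h \<xi>) sums (f (of_real r * \<xi>) * h \<xi>)"
        by (intro sums_mult2 a assms(2,3) of_real_mult_in_disc elim)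
      then show ?case by (simp add: u_def sums_iff power_mult_distrib mult_ac)
    qed
  qed (simp_all add: u_def)
  ultimately show ?thesis by (simp add: u_def)
qed

text \<open>Expanding \<open>f\<close> leaves the integrals of \<open>\<xi> ^ n * cnj (g (r * \<xi>))\<close>; expanding \<open>g\<close> in its turn,
  orthonormality of the monomials picks out one coefficient. Any power series of \<open>f\<close> and \<open>g\<close> may be
  used, so for the Cauchy kernel the geometric series will do.\<close>

lemma parseval:
  assumes f: "disc_function f" and g: "disc_function g" and r: "0 \<le> r" "r < 1"
    and a: "\<And>z. z \<in> ball 0 1 \<Longrightarrow> (\<lambda>n. a n * z ^ n) sums f z"
    and b: "\<And>z. z \<in> ball 0 1 \<Longrightarrow> (\<lambda>n. b n * z ^ n) sums g z"
  shows "(\<lambda>n. a n * cnj (b n) * of_real (r ^ (2 * n))) sums circle_pairing r f g"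
proof -
  obtain B where B: "\<And>\<xi>. cmod \<xi> = 1 \<Longrightarrow> cmod (g (of_real r * \<xi>)) \<le> B"
    using disc_function_bounded_on_circle[OF g r] by blast
  have mg [measurable]: "g \<in> borel_measurable borel" using g by (rule disc_function_borel)
  have coeff: "(LINT \<xi>|circle_measure. \<xi> ^ n * cnj (g (of_real r * \<xi>))) = cnj (b n) * of_real r ^ n" for n
  proof -
    have "(\<lambda>m. b m * of_real r ^ m * (LINT \<xi>|circle_measure. \<xi> ^ m * cnj (\<xi> ^ n))) sums
     (LINT \<xi>|circle_measure. g (of_real r * \<xi>) * cnj (\<xi> ^ n))"
      by (rule powser_circle_integral_sums[OF g r b, where B=1]) (auto simp: norm_power simp del: complex_cnj_power)
    then have "(\<lambda>m. if m = n then b m * of_real r ^ m else 0) sums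
     (LINT \<xi>|circle_measure. g (of_real r * \<xi>) * cnj (\<xi> ^ n))"
      unfolding circle_monomials_orthonormal by (simp add: if_distrib cong: if_cong)
    then have "(LINT \<xi>|circle_measure. g (of_real r * \<xi>) * cnj (\<xi> ^ n)) = b n * of_real r ^ n"
      using sums_single[of n "\<lambda>m. b m * of_real r ^ m"] by (metis (lifting) sums_unique2)
    then have "cnj (LINT \<xi>|circle_measure. g (of_real r * \<xi>) * cnj (\<xi> ^ n)) = cnj (b n) * of_real r ^ n"
      by simp
    then show ?thesis
      by (simp add: mult.commute flip: Bochner_Integration.integral_cnj)
  qed
  have "(\<lambda>n. a n * of_real r ^ n * (LINT \<xi>|circle_measure. \<xi> ^ n * cnj (g (of_real r * \<xi>)))) sums
     (LINT \<xi>|circle_measure. f (of_real r * \<xi>) * cnj (g (of_real r * \<xi>)))"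
    by (rule powser_circle_integral_sums[OF f r a, where B=B]) (use B in auto)
  then show ?thesis
    unfolding coeff circle_pairing_def mult_2 power_add of_real_mult of_real_power
    by (simp only: mult_ac)
qed

section \<open>The Hardy space as an inner product space\<close>

lemma hardy2_disc_function: "f \<in> hardy2 \<Longrightarrow> disc_function f"
  by (auto simp: hardy2_def disc_function_def)

lemma circle_pairing_self:
  "circle_pairing r f f = of_real (LINT \<xi>|circle_measure. (cmod (f (of_real r * \<xi>)))\<^sup>2)"
  unfolding circle_pairing_def complex_norm_square[symmetric] by (rule integral_complex_of_real)

lemma circle_square_integrable:
  assumes "disc_function f" "0 \<le> r" "r < 1"
  shows "integrable circle_measure (\<lambda>\<xi>. (cmod (f (of_real r * \<xi>)))\<^sup>2)"
proof -
  have "integrable circle_measure (\<lambda>\<xi>. complex_of_real ((cmod (f (of_real r * \<xi>)))\<^sup>2))"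
    using circle_pairing_integrable[OF assms(1,1,2,3)] by (simp add: complex_norm_square del: of_real_power)
  then show ?thesis by (simp only: complex_of_real_integrable_eq)
qed

lemma hardy2_square_bound:
  assumes "f \<in> hardy2"
  obtains M where "0 \<le> M"
    "\<And>r. 0 \<le> r \<Longrightarrow> r < 1 \<Longrightarrow> (LINT \<xi>|circle_measure. (cmod (f (of_real r * \<xi>)))\<^sup>2) \<le> M"
proof -
  from assms have "bdd_above ((\<lambda>r. LINT \<xi>|circle_measure. (cmod (f (of_real r * \<xi>)))\<^sup>2) ` {0..<1})"
    by (auto simp: hardy2_def)
  then obtain M where "\<forall>r\<in>{0..<1}. (LINT \<xi>|circle_measure. (cmod (f (of_real r * \<xi>)))\<^sup>2) \<le> M"
    unfolding bdd_above_def by auto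
  then show thesis using that[of "max M 0"] by (auto simp: le_max_iff_disj)
qed

lemma hardy2I:
  assumes "disc_function f"
    "\<And>r. 0 \<le> r \<Longrightarrow> r < 1 \<Longrightarrow> (LINT \<xi>|circle_measure. (cmod (f (of_real r * \<xi>)))\<^sup>2) \<le> M"
  shows "f \<in> hardy2"
  using assms unfolding hardy2_def disc_function_def by (auto intro!: bdd_aboveI[of _ M])

lemma hardy2_bounded:
  assumes f: "disc_function f" and B: "\<And>z. z \<in> ball 0 1 \<Longrightarrow> cmod (f z) \<le> B"
  shows "f \<in> hardy2"
proof (rule hardy2I[OF f])
  fix r :: real assume r: "0 \<le> r" "r < 1"
  have "(LINT \<xi>|circle_measure. (cmod (f (of_real r * \<xi>)))\<^sup>2) \<le> (LINT \<xi>|circle_measure. B\<^sup>2)"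
  proof (rule integral_mono_AE)
    show "AE \<xi> in circle_measure. (cmod (f (of_real r * \<xi>)))\<^sup>2 \<le> B\<^sup>2"
      using AE_circle
      by eventually_elim (auto intro!: power_mono B simp del: mem_ball intro: of_real_mult_in_disc r)
  qed (use circle_square_integrable[OF f r] in auto)
  then show "(LINT \<xi>|circle_measure. (cmod (f (of_real r * \<xi>)))\<^sup>2) \<le> B\<^sup>2"
    by (simp add: measure_circle_measure_UNIV)
qed

lemma hardy2_zero: "(\<lambda>z. 0) \<in> hardy2"
  by (rule hardy2_bounded[of _ 0]) (auto simp: disc_function_def)

lemma hardy2_add_scaled:
  assumes f: "f \<in> hardy2" and g: "g \<in> hardy2"
  shows "(\<lambda>z. f z + c * g z) \<in> hardy2"
proof -
  obtain A where A: "\<And>r. 0 \<le> r \<Longrightarrow> r < 1 \<Longrightarrow> (LINT \<xi>|circle_measure. (cmod (f (of_real r * \<xi>)))\<^sup>2) \<le> A"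
    using hardy2_square_bound[OF f] by blast
  obtain B where B: "\<And>r. 0 \<le> r \<Longrightarrow> r < 1 \<Longrightarrow> (LINT \<xi>|circle_measure. (cmod (g (of_real r * \<xi>)))\<^sup>2) \<le> B"
    using hardy2_square_bound[OF g] by blast
  note df = hardy2_disc_function[OF f] and dg = hardy2_disc_function[OF g]
  have d: "disc_function (\<lambda>z. f z + c * g z)"
    using df dg by (auto simp: disc_function_def intro!: holomorphic_intros)
  show ?thesis
  proof (rule hardy2I[OF d])
    fix r :: real assume r: "0 \<le> r" "r < 1"
    have sq: "(cmod (a + c * b))\<^sup>2 \<le> 2 * (cmod a)\<^sup>2 + 2 * (cmod c)\<^sup>2 * (cmod b)\<^sup>2" for a b
    proof -
      have "(cmod (a + c * b))\<^sup>2 \<le> (cmod a + cmod (c * b))\<^sup>2"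
        by (intro power_mono norm_triangle_ineq) auto
      also have "\<dots> \<le> 2 * (cmod a)\<^sup>2 + 2 * (cmod (c * b))\<^sup>2"
        using zero_le_power2[of "cmod a - cmod (c * b)"] by (simp add: power2_eq_square algebra_simps)
      finally show ?thesis by (simp add: norm_mult power_mult_distrib mult_ac)
    qed
    have "(LINT \<xi>|circle_measure. (cmod (f (of_real r * \<xi>) + c * g (of_real r * \<xi>)))\<^sup>2)
      \<le> (LINT \<xi>|circle_measure. 2 * (cmod (f (of_real r * \<xi>)))\<^sup>2 + 2 * (cmod c)\<^sup>2 * (cmod (g (of_real r * \<xi>)))\<^sup>2)"
      using circle_square_integrable[OF df r] circle_square_integrable[OF dg r]
        circle_square_integrable[OF d r]
      by (intro integral_mono sq Bochner_Integration.integrable_add integrable_mult_right) auto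
    also have "\<dots> = 2 * (LINT \<xi>|circle_measure. (cmod (f (of_real r * \<xi>)))\<^sup>2)
        + 2 * (cmod c)\<^sup>2 * (LINT \<xi>|circle_measure. (cmod (g (of_real r * \<xi>)))\<^sup>2)"
      using circle_square_integrable[OF df r] circle_square_integrable[OF dg r]
      by (subst Bochner_Integration.integral_add) auto
    also have "\<dots> \<le> 2 * A + 2 * (cmod c)\<^sup>2 * B"
      using A[OF r] B[OF r] by (intro add_mono mult_left_mono) auto
    finally show "(LINT \<xi>|circle_measure. (cmod (f (of_real r * \<xi>) + c * g (of_real r * \<xi>)))\<^sup>2)
      \<le> 2 * A + 2 * (cmod c)\<^sup>2 * B" .
  qed
qed

lemma hardy2_scale: "f \<in> hardy2 \<Longrightarrow> (\<lambda>z. c * f z) \<in> hardy2"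
  using hardy2_add_scaled[OF hardy2_zero, of f c] by simp

lemma hardy2_add: "f \<in> hardy2 \<Longrightarrow> g \<in> hardy2 \<Longrightarrow> (\<lambda>z. f z + g z) \<in> hardy2"
  using hardy2_add_scaled[of f g 1] by simp

lemma hardy2_diff: "f \<in> hardy2 \<Longrightarrow> g \<in> hardy2 \<Longrightarrow> (\<lambda>z. f z - g z) \<in> hardy2"
  using hardy2_add_scaled[of f g "-1"] by simp

lemma hardy2_sum:
  assumes "\<And>i. i \<in> I \<Longrightarrow> f i \<in> hardy2"
  shows "(\<lambda>z. \<Sum>i\<in>I. c i * f i z) \<in> hardy2"
  using assms
  by (induction I rule: infinite_finite_induct) (auto simp: hardy2_zero intro!: hardy2_add hardy2_scale)

text \<open>Let \<open>r \<rightarrow> 1\<close> in the partial sums of the Parseval series, which the integral means bound.\<close>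

lemma hardy2_coeffs_square_summable:
  assumes "f \<in> hardy2"
  shows "summable (\<lambda>n. (cmod (taylor_coeff f n))\<^sup>2)"
proof -
  obtain M where M: "\<And>r. 0 \<le> r \<Longrightarrow> r < 1 \<Longrightarrow> (LINT \<xi>|circle_measure. (cmod (f (of_real r * \<xi>)))\<^sup>2) \<le> M"
    using hardy2_square_bound[OF assms] by blast
  note d = hardy2_disc_function[OF assms]
  have "(\<Sum>n<N. (cmod (taylor_coeff f n))\<^sup>2) \<le> M" for N
  proof -
    have "(\<Sum>n<N. (cmod (taylor_coeff f n))\<^sup>2 * r ^ (2 * n)) \<le> M" if r: "0 \<le> r" "r < 1" for r :: real
    proof -
      have "(\<lambda>n. complex_of_real ((cmod (taylor_coeff f n))\<^sup>2 * r ^ (2 * n))) sums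
          of_real (LINT \<xi>|circle_measure. (cmod (f (of_real r * \<xi>)))\<^sup>2)"
        using parseval[OF d d r taylor_sums[OF d] taylor_sums[OF d]] unfolding circle_pairing_self of_real_mult complex_norm_square .
      then have *: "(\<lambda>n. (cmod (taylor_coeff f n))\<^sup>2 * r ^ (2 * n)) sums
          (LINT \<xi>|circle_measure. (cmod (f (of_real r * \<xi>)))\<^sup>2)"
        by (simp only: sums_of_real_iff)
      have "(\<Sum>n<N. (cmod (taylor_coeff f n))\<^sup>2 * r ^ (2 * n)) \<le>
          (LINT \<xi>|circle_measure. (cmod (f (of_real r * \<xi>)))\<^sup>2)"
        unfolding sums_unique[OF *] by (rule sum_le_suminf) (use * r in \<open>auto simp: sums_iff\<close>)
      with M[OF r] show ?thesis by simp
    qed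
    then have "\<forall>\<^sub>F r in at_left (1::real). (\<Sum>n<N. (cmod (taylor_coeff f n))\<^sup>2 * r ^ (2 * n)) \<le> M"
      using eventually_at_left_real[of 0 1] by (auto elim: eventually_mono)
    moreover have "((\<lambda>r. \<Sum>n<N. (cmod (taylor_coeff f n))\<^sup>2 * r ^ (2 * n)) \<longlongrightarrow>
        (\<Sum>n<N. (cmod (taylor_coeff f n))\<^sup>2 * 1 ^ (2 * n))) (at_left (1::real))"
      by (intro tendsto_intros)
    ultimately show ?thesis
      by (intro tendsto_upperbound[where F = "at_left (1::real)"]) auto
  qed
  then show ?thesis
    by (intro summableI_nonneg_bounded[of _ M]) auto
qed

lemma eventually_radius: "\<forall>\<^sub>F r in at_left (1::real). 0 \<le> r \<and> r < 1"
  using eventually_at_left_real[of 0 1] by (auto elim: eventually_mono)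

lemma hardy_innerI:
  assumes "((\<lambda>r. circle_pairing r f g) \<longlongrightarrow> l) (at_left 1)"
  shows "hardy_inner f g = l"
  unfolding hardy_inner_def using assms unfolding circle_pairing_def
  by (intro tendsto_Lim) auto

text \<open>By Parseval, the approximants are a power series in \<open>r\<^sup>2\<close> with absolutely summable coefficients,
  and Tannery's theorem permits \<open>r \<rightarrow> 1\<close> in each term. The limit in \<open>hardy_inner\<close> therefore exists, and
  the algebraic rules for the inner product are inherited from the approximants.\<close>

lemma hardy_inner_tendsto:
  assumes f: "f \<in> hardy2" and g: "g \<in> hardy2"
  shows "((\<lambda>r. circle_pairing r f g) \<longlongrightarrow> hardy_inner f g) (at_left 1)"
proof -
  define c where "c = (\<lambda>n. taylor_coeff f n * cnj (taylor_coeff g n))"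
  have "summable (\<lambda>n. (cmod (taylor_coeff f n))\<^sup>2 + (cmod (taylor_coeff g n))\<^sup>2)"
    by (intro summable_add hardy2_coeffs_square_summable f g)
  moreover have "norm (cmod (c n)) \<le> (cmod (taylor_coeff f n))\<^sup>2 + (cmod (taylor_coeff g n))\<^sup>2" for n
  proof -
    have "cmod (c n) = cmod (taylor_coeff f n) * cmod (taylor_coeff g n)"
      by (simp add: c_def norm_mult)
    moreover have "2 * (cmod (taylor_coeff f n) * cmod (taylor_coeff g n)) \<le>
        (cmod (taylor_coeff f n))\<^sup>2 + (cmod (taylor_coeff g n))\<^sup>2"
      using sum_squares_bound[of "cmod (taylor_coeff f n)" "cmod (taylor_coeff g n)"] by (simp add: mult_ac)
    moreover have "0 \<le> cmod (c n)" by simp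
    ultimately show ?thesis unfolding real_norm_def by linarith
  qed
  ultimately have c: "summable (\<lambda>n. cmod (c n))"
    by (rule summable_comparison_test'[where N = 0])
  have "((\<lambda>r. \<Sum>n. c n * of_real (r ^ (2 * n))) \<longlongrightarrow> suminf c) (at_left (1::real))"
  proof (rule tannerys_theorem[THEN conjunct2, THEN conjunct2])
    show "((\<lambda>r. c n * of_real (r ^ (2 * n))) \<longlongrightarrow> c n) (at_left (1::real))" for n
      by (rule tendsto_eq_intros refl | simp)+
    show "\<forall>\<^sub>F (n, r) in at_top \<times>\<^sub>F at_left (1::real). norm (c n * of_real (r ^ (2 * n))) \<le> cmod (c n)"
      unfolding eventually_prod_filter
      by (rule exI[of _ "\<lambda>_. True"], rule exI[of _ "\<lambda>r. 0 \<le> r \<and> r < 1"])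
        (auto simp: eventually_radius norm_mult norm_power intro!: mult_left_le power_le_one)
  qed (use c in auto)
  moreover have "\<forall>\<^sub>F r in at_left (1::real). (\<Sum>n. c n * of_real (r ^ (2 * n))) = circle_pairing r f g"
    using eventually_radius
  proof eventually_elim
    case (elim r)
    show ?case
      using parseval[OF hardy2_disc_function[OF f] hardy2_disc_function[OF g] _ _
          taylor_sums[OF hardy2_disc_function[OF f]] taylor_sums[OF hardy2_disc_function[OF g]], of r] elim
      by (simp add: c_def sums_iff)
  qed
  ultimately have "((\<lambda>r. circle_pairing r f g) \<longlongrightarrow> suminf c) (at_left 1)"
    by (rule Lim_transform_eventually)
  then show ?thesis using hardy_innerI by metis
qed

lemma circle_pairing_add_scaled:
  assumes "disc_function f" "disc_function g" "disc_function h" "0 \<le> r" "r < 1"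
  shows "circle_pairing r (\<lambda>z. f z + c * g z) h = circle_pairing r f h + c * circle_pairing r g h"
  unfolding circle_pairing_def
  using circle_pairing_integrable[OF assms(1,3,4,5)] circle_pairing_integrable[OF assms(2,3,4,5)]
  by (simp add: distrib_right mult.assoc)

lemma circle_pairing_cnj: "circle_pairing r g f = cnj (circle_pairing r f g)"
  unfolding circle_pairing_def by (simp add: mult.commute flip: Bochner_Integration.integral_cnj)

lemma hardy_inner_add_scaled:
  assumes f: "f \<in> hardy2" and g: "g \<in> hardy2" and h: "h \<in> hardy2"
  shows "hardy_inner (\<lambda>z. f z + c * g z) h = hardy_inner f h + c * hardy_inner g h"
proof (rule hardy_innerI)
  have "((\<lambda>r. circle_pairing r f h + c * circle_pairing r g h) \<longlongrightarrow>
      hardy_inner f h + c * hardy_inner g h) (at_left 1)"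
    by (intro tendsto_intros hardy_inner_tendsto assms)
  moreover have "\<forall>\<^sub>F r in at_left (1::real). circle_pairing r f h + c * circle_pairing r g h =
      circle_pairing r (\<lambda>z. f z + c * g z) h"
    using eventually_radius
    by eventually_elim (simp add: circle_pairing_add_scaled assms hardy2_disc_function)
  ultimately show "((\<lambda>r. circle_pairing r (\<lambda>z. f z + c * g z) h) \<longlongrightarrow>
      hardy_inner f h + c * hardy_inner g h) (at_left 1)"
    by (rule Lim_transform_eventually)
qed

lemma hardy_inner_cnj:
  assumes "f \<in> hardy2" "g \<in> hardy2"
  shows "hardy_inner g f = cnj (hardy_inner f g)"
  unfolding hardy_innerI[OF tendsto_cnj[OF hardy_inner_tendsto[OF assms], folded circle_pairing_cnj]] ..

lemma hardy_inner_zero: "hardy_inner (\<lambda>z. 0) h = 0"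
  by (rule hardy_innerI) (simp add: circle_pairing_def)

lemma hardy_inner_sum:
  assumes "\<And>i. i \<in> I \<Longrightarrow> f i \<in> hardy2" "h \<in> hardy2"
  shows "hardy_inner (\<lambda>z. \<Sum>i\<in>I. c i * f i z) h = (\<Sum>i\<in>I. c i * hardy_inner (f i) h)"
  using assms
proof (induction I rule: infinite_finite_induct)
  case (insert i I)
  have "hardy_inner (\<lambda>z. (\<Sum>i\<in>I. c i * f i z) + c i * f i z) h =
      hardy_inner (\<lambda>z. \<Sum>i\<in>I. c i * f i z) h + c i * hardy_inner (f i) h"
    using insert.prems by (intro hardy_inner_add_scaled hardy2_sum) auto
  with insert show ?case by (simp add: add.commute)
qed (auto simp: hardy_inner_zero)

lemma hardy_inner_sum_sum:
  assumes "\<And>i. i \<in> I \<Longrightarrow> f i \<in> hardy2"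
  shows "hardy_inner (\<lambda>z. \<Sum>i\<in>I. c i * f i z) (\<lambda>z. \<Sum>i\<in>I. c i * f i z) =
     (\<Sum>i\<in>I. \<Sum>j\<in>I. c i * cnj (c j) * hardy_inner (f i) (f j))"
proof -
  let ?s = "\<lambda>z. \<Sum>i\<in>I. c i * f i z"
  have s: "?s \<in> hardy2" using assms by (rule hardy2_sum)
  have "hardy_inner ?s ?s = (\<Sum>i\<in>I. c i * hardy_inner (f i) ?s)"
    using assms s by (rule hardy_inner_sum)
  also have "\<dots> = (\<Sum>i\<in>I. c i * (\<Sum>j\<in>I. cnj (c j) * hardy_inner (f i) (f j)))"
  proof (intro sum.cong refl arg_cong2[of _ _ _ _ "(*)"])
    fix i assume i: "i \<in> I"
    have "hardy_inner (f i) ?s = cnj (\<Sum>j\<in>I. c j * hardy_inner (f j) (f i))"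
      using hardy_inner_cnj[OF s assms[OF i]] hardy_inner_sum[of I f "f i" c] assms i by simp
    also have "\<dots> = (\<Sum>j\<in>I. cnj (c j) * hardy_inner (f i) (f j))"
      unfolding cnj_sum complex_cnj_mult
      by (intro sum.cong refl arg_cong2[of _ _ _ _ "(*)"] hardy_inner_cnj[symmetric] assms i)
    finally show "hardy_inner (f i) ?s = (\<Sum>j\<in>I. cnj (c j) * hardy_inner (f i) (f j))" .
  qed
  finally show ?thesis by (simp add: sum_distrib_left mult.assoc)
qed

lemma hardy_inner_self:
  assumes "f \<in> hardy2"
  shows "hardy_inner f f = of_real ((hardy_norm f)\<^sup>2)" "0 \<le> Re (hardy_inner f f)"
proof -
  show "0 \<le> Re (hardy_inner f f)"
    using tendsto_Re[OF hardy_inner_tendsto[OF assms assms]]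
    by (rule tendsto_lowerbound) (auto simp: circle_pairing_self)
  moreover have "hardy_inner f f = cnj (hardy_inner f f)"
    by (rule hardy_inner_cnj[OF assms assms])
  ultimately show "hardy_inner f f = of_real ((hardy_norm f)\<^sup>2)"
    by (simp add: hardy_norm_def complex_eq_iff)
qed

lemma hardy_norm_square: "f \<in> hardy2 \<Longrightarrow> (hardy_norm f)\<^sup>2 = Re (hardy_inner f f)"
  by (simp add: hardy_inner_self)

lemma hardy_norm_nonneg: "f \<in> hardy2 \<Longrightarrow> 0 \<le> hardy_norm f"
  unfolding hardy_norm_def by (intro real_sqrt_ge_zero hardy_inner_self(2))

lemma hardy_norm_add_scaled_square:
  assumes "f \<in> hardy2" "g \<in> hardy2"
  shows "(hardy_norm (\<lambda>z. f z + c * g z))\<^sup>2 =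
    (hardy_norm f)\<^sup>2 + 2 * Re (cnj c * hardy_inner f g) + (cmod c)\<^sup>2 * (hardy_norm g)\<^sup>2"
proof -
  let ?h = "\<lambda>z. f z + c * g z"
  have h: "?h \<in> hardy2" by (intro hardy2_add_scaled assms)
  have l: "hardy_inner ?h k = hardy_inner f k + c * hardy_inner g k" if "k \<in> hardy2" for k
    by (intro hardy_inner_add_scaled assms that)
  have r: "hardy_inner k ?h = cnj (hardy_inner ?h k)" if "k \<in> hardy2" for k
    by (rule hardy_inner_cnj[OF h that])
  have "hardy_inner ?h ?h = cnj (hardy_inner f f + c * hardy_inner g f) +
      c * cnj (hardy_inner f g + c * hardy_inner g g)"
    using l[OF h] r[OF assms(1)] r[OF assms(2)] l[OF assms(1)] l[OF assms(2)] by simp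
  also have "\<dots> = of_real ((hardy_norm f)\<^sup>2) + (cnj c * hardy_inner f g + cnj (cnj c * hardy_inner f g))
      + c * cnj c * of_real ((hardy_norm g)\<^sup>2)"
    unfolding hardy_inner_cnj[OF assms] hardy_inner_self(1)[OF assms(1)] hardy_inner_self(1)[OF assms(2)]
    by (simp only: complex_cnj_add complex_cnj_mult complex_cnj_cnj complex_cnj_complex_of_real
        distrib_left mult_ac add_ac)
  also have "\<dots> = of_real ((hardy_norm f)\<^sup>2 + 2 * Re (cnj c * hardy_inner f g) + (cmod c)\<^sup>2 * (hardy_norm g)\<^sup>2)"
    unfolding complex_add_cnj complex_norm_square[symmetric] of_real_add of_real_mult ..
  finally show ?thesis using hardy_norm_square[OF h] by simp
qed

lemma hardy_Cauchy_Schwarz: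
  assumes "f \<in> hardy2" "g \<in> hardy2"
  shows "cmod (hardy_inner f g) \<le> hardy_norm f * hardy_norm g"
proof -
  define a where "a = cmod (hardy_inner f g)"
  define B where "B = (hardy_norm g)\<^sup>2"
  \<comment> \<open>The square norm of \<open>f - s\<langle>f, g\<rangle>g\<close> is nonnegative for every real \<open>s\<close>.\<close>
  have quad: "0 \<le> (hardy_norm f)\<^sup>2 - 2 * s * a\<^sup>2 + s\<^sup>2 * a\<^sup>2 * B" for s :: real
  proof -
    let ?c = "- (of_real s * hardy_inner f g)"
    have "0 \<le> (hardy_norm (\<lambda>z. f z + ?c * g z))\<^sup>2" by simp
    also have "\<dots> = (hardy_norm f)\<^sup>2 + 2 * Re (cnj ?c * hardy_inner f g) + (cmod ?c)\<^sup>2 * B"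
      unfolding B_def by (rule hardy_norm_add_scaled_square[OF assms])
    also have "cnj ?c * hardy_inner f g = - of_real (s * a\<^sup>2)"
      unfolding a_def of_real_mult complex_norm_square by simp
    finally show ?thesis by (simp add: a_def norm_mult power_mult_distrib)
  qed
  have "a\<^sup>2 \<le> (hardy_norm f)\<^sup>2 * B"
  proof (cases "B = 0")
    case True
    have "a\<^sup>2 = 0"
    proof (rule ccontr)
      assume "a\<^sup>2 \<noteq> 0"
      then show False
        using quad[of "((hardy_norm f)\<^sup>2 + 1) / (2 * a\<^sup>2)"] True by (simp add: field_simps)
    qed
    then show ?thesis using True by simp
  next
    case False
    then have "B > 0" by (simp add: B_def)
    then show ?thesis using quad[of "1 / B"] by (simp add: field_simps power2_eq_square)
  qed
  then have "a\<^sup>2 \<le> (hardy_norm f * hardy_norm g)\<^sup>2" by (simp add: B_def power_mult_distrib)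
  then show ?thesis
    unfolding a_def by (rule power2_le_imp_le) (simp add: hardy_norm_nonneg assms)
qed

lemma hardy_norm_triangle:
  assumes "f \<in> hardy2" "g \<in> hardy2"
  shows "hardy_norm (\<lambda>z. f z + g z) \<le> hardy_norm f + hardy_norm g"
proof -
  have "(hardy_norm (\<lambda>z. f z + g z))\<^sup>2 = (hardy_norm f)\<^sup>2 + 2 * Re (hardy_inner f g) + (hardy_norm g)\<^sup>2"
    using hardy_norm_add_scaled_square[OF assms, of 1] by simp
  also have "\<dots> \<le> (hardy_norm f)\<^sup>2 + 2 * (hardy_norm f * hardy_norm g) + (hardy_norm g)\<^sup>2"
    using complex_Re_le_cmod[of "hardy_inner f g"] hardy_Cauchy_Schwarz[OF assms] by simp
  also have "\<dots> = (hardy_norm f + hardy_norm g)\<^sup>2" by (simp add: power2_sum)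
  finally show ?thesis
    by (rule power2_le_imp_le) (simp add: hardy_norm_nonneg assms)
qed

section \<open>Reproducing kernels of the model space\<close>

definition cauchy_kernel :: "complex \<Rightarrow> complex \<Rightarrow> complex" where
  "cauchy_kernel w z = (if z \<in> ball 0 1 then 1 / (1 - cnj w * z) else 0)"

lemma norm_one_minus_cnj_mult_ge:
  assumes "w \<in> ball 0 1" "z \<in> ball 0 1"
  shows "1 - cmod w \<le> cmod (1 - cnj w * z)" "1 - cnj w * z \<noteq> 0"
proof -
  have "cmod (cnj w * z) \<le> cmod w * 1"
    unfolding norm_mult complex_mod_cnj using assms by (intro mult_left_mono) auto
  then show *: "1 - cmod w \<le> cmod (1 - cnj w * z)"
    using norm_triangle_ineq2[of 1 "cnj w * z"] by simp
  show "1 - cnj w * z \<noteq> 0" using * assms by auto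
qed

lemma disc_function_cauchy_kernel:
  assumes "w \<in> ball 0 1"
  shows "disc_function (cauchy_kernel w)"
proof -
  have "(\<lambda>z. 1 / (1 - cnj w * z)) holomorphic_on ball 0 1"
    using norm_one_minus_cnj_mult_ge(2)[OF assms] by (intro holomorphic_intros) auto
  then have "cauchy_kernel w holomorphic_on ball 0 1"
    by (rule holomorphic_transform) (simp add: cauchy_kernel_def)
  then show ?thesis by (simp add: disc_function_def cauchy_kernel_def)
qed

lemma cauchy_kernel_bound:
  assumes "w \<in> ball 0 1" "z \<in> ball 0 1"
  shows "cmod (cauchy_kernel w z) \<le> 1 / (1 - cmod w)"
  using norm_one_minus_cnj_mult_ge(1)[OF assms] assms
  by (auto simp: cauchy_kernel_def norm_divide intro!: divide_left_mono mult_pos_pos)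

lemma cauchy_kernel_hardy2: "w \<in> ball 0 1 \<Longrightarrow> cauchy_kernel w \<in> hardy2"
  using hardy2_bounded[OF disc_function_cauchy_kernel cauchy_kernel_bound] by blast

text \<open>Parseval with the geometric series evaluates the approximant at radius \<open>r\<close> as \<open>f (r\<^sup>2 * w)\<close>.\<close>

lemma hardy_inner_cauchy_kernel:
  assumes f: "f \<in> hardy2" and w: "w \<in> ball 0 1"
  shows "hardy_inner f (cauchy_kernel w) = f w"
proof (rule hardy_innerI)
  note d = hardy2_disc_function[OF f]
  have ck: "(\<lambda>n. cnj w ^ n * z ^ n) sums cauchy_kernel w z" if "z \<in> ball 0 1" for z
  proof -
    have "cmod w * cmod z < 1 * 1"
      using w that by (intro mult_strict_mono) auto
    then have "(\<lambda>n. (cnj w * z) ^ n) sums (1 / (1 - cnj w * z))"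
      by (intro geometric_sums) (simp add: norm_mult)
    then show ?thesis using that by (simp add: cauchy_kernel_def power_mult_distrib)
  qed
  have in_ball: "(of_real (r\<^sup>2)) * w \<in> ball 0 1" if "0 \<le> r" "r < 1" for r :: real
  proof -
    have "r\<^sup>2 * cmod w \<le> 1 * cmod w"
      using that by (intro mult_right_mono power_le_one) auto
    with w show ?thesis by (simp add: norm_mult norm_power)
  qed
  have eq: "circle_pairing r f (cauchy_kernel w) = f (of_real (r\<^sup>2) * w)" if r: "0 \<le> r" "r < 1" for r
  proof -
    have "(\<lambda>n. taylor_coeff f n * (of_real (r\<^sup>2) * w) ^ n) sums circle_pairing r f (cauchy_kernel w)"
      using parseval[OF d disc_function_cauchy_kernel[OF w] r taylor_sums[OF d] ck]
      unfolding power_mult power_mult_distrib of_real_power[symmetric]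
      by (simp only: complex_cnj_power complex_cnj_cnj mult_ac)
    then show ?thesis using taylor_sums[OF d in_ball[OF r]] sums_unique2 by blast
  qed
  have "isCont f w"
    using d w unfolding disc_function_def
    by (meson continuous_on_eq_continuous_at holomorphic_on_imp_continuous_on open_ball)
  moreover have "((\<lambda>r. of_real (r\<^sup>2) * w) \<longlongrightarrow> w) (at_left (1::real))"
    by (rule tendsto_eq_intros refl | simp)+
  ultimately have "((\<lambda>r. f (of_real (r\<^sup>2) * w)) \<longlongrightarrow> f w) (at_left (1::real))"
    by (rule isCont_tendsto_compose)
  moreover have "\<forall>\<^sub>F r in at_left (1::real). f (of_real (r\<^sup>2) * w) = circle_pairing r f (cauchy_kernel w)"
    using eventually_radius by eventually_elim (simp only: eq)
  ultimately show "((\<lambda>r. circle_pairing r f (cauchy_kernel w)) \<longlongrightarrow> f w) (at_left 1)"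
    by (rule Lim_transform_eventually)
qed

lemma inner_mult_disc_function:
  assumes "inner_function \<theta>" "disc_function g"
  shows "disc_function (\<lambda>z. \<theta> z * g z)"
  using assms by (auto simp: disc_function_def inner_function_def intro!: holomorphic_intros)

lemma inner_mult_hardy2:
  assumes \<theta>: "inner_function \<theta>" and g: "g \<in> hardy2"
  shows "(\<lambda>z. \<theta> z * g z) \<in> hardy2"
proof -
  note dg = hardy2_disc_function[OF g]
  note d = inner_mult_disc_function[OF \<theta> dg]
  obtain M where M: "\<And>r. 0 \<le> r \<Longrightarrow> r < 1 \<Longrightarrow> (LINT \<xi>|circle_measure. (cmod (g (of_real r * \<xi>)))\<^sup>2) \<le> M"
    using hardy2_square_bound[OF g] by blast
  show ?thesis
  proof (rule hardy2I[OF d])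
    fix r :: real assume r: "0 \<le> r" "r < 1"
    have "(LINT \<xi>|circle_measure. (cmod (\<theta> (of_real r * \<xi>) * g (of_real r * \<xi>)))\<^sup>2)
      \<le> (LINT \<xi>|circle_measure. (cmod (g (of_real r * \<xi>)))\<^sup>2)"
    proof (rule integral_mono_AE)
      show "AE \<xi> in circle_measure. (cmod (\<theta> (of_real r * \<xi>) * g (of_real r * \<xi>)))\<^sup>2 \<le> (cmod (g (of_real r * \<xi>)))\<^sup>2"
        using AE_circle
      proof eventually_elim
        case (elim \<xi>)
        have "cmod (\<theta> (of_real r * \<xi>)) \<le> 1"
          using \<theta> of_real_mult_in_disc[OF elim r] by (auto simp: inner_function_def)
        then show ?case
          by (auto simp: norm_mult intro!: power_mono mult_left_le_one_le)
      qed
    qed (use circle_square_integrable[OF d r] circle_square_integrable[OF dg r] in auto)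
    with M[OF r] show "(LINT \<xi>|circle_measure. (cmod (\<theta> (of_real r * \<xi>) * g (of_real r * \<xi>)))\<^sup>2) \<le> M"
      by simp
  qed
qed

text \<open>Dominated convergence, as the boundary values of \<open>\<theta>\<close> are unimodular almost everywhere. Since
  \<open>\<theta>\<close> is arbitrary off the disc, the indicator is what makes the integrand measurable.\<close>

lemma inner_function_defect_tendsto:
  assumes \<theta>: "inner_function \<theta>"
  defines "W \<equiv> \<lambda>r::real. LINT \<xi>|circle_measure. 1 - (cmod (\<theta> (of_real r * \<xi>) * indicator (ball 0 1) (of_real r * \<xi>)))\<^sup>2"
  shows "(W \<longlongrightarrow> 0) (at_left 1)"
proof (rule tendsto_at_left_sequentially[of 0])
  fix S :: "nat \<Rightarrow> real"
  assume S: "\<And>n. S n < 1" "\<And>n. 0 < S n" "S \<longlonglongrightarrow> 1"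
  have d: "disc_function (\<lambda>z. \<theta> z * indicator (ball 0 1) z)"
    using \<theta> unfolding disc_function_def inner_function_def
    by (auto intro!: holomorphic_transform[of \<theta>])
  note [measurable] = disc_function_borel[OF d]
  have inb: "of_real (S n) * \<xi> \<in> ball 0 1" if "cmod \<xi> = 1" for n \<xi>
    using that S(1,2)[of n] by (intro of_real_mult_in_disc) auto
  have "(\<lambda>n. W (S n)) \<longlonglongrightarrow> (LINT \<xi>|circle_measure. 0)"
    unfolding W_def
  proof (rule integral_dominated_convergence[where w = "\<lambda>_. 1"])
    have "AE \<xi> in circle_measure. \<exists>w. cmod w = 1 \<and> ((\<lambda>r::real. \<theta> (of_real r * \<xi>)) \<longlongrightarrow> w) (at_left 1)"
      using \<theta> by (simp add: inner_function_def)
    then show "AE \<xi> in circle_measure. (\<lambda>n. 1 - (cmod (\<theta> (of_real (S n) * \<xi>) * indicator (ball 0 1) (of_real (S n) * \<xi>)))\<^sup>2) \<longlonglongrightarrow> 0"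
      using AE_circle
    proof eventually_elim
      case (elim \<xi>)
      then obtain w where w: "cmod w = 1" "((\<lambda>r::real. \<theta> (of_real r * \<xi>)) \<longlongrightarrow> w) (at_left 1)"
        by blast
      have "filterlim S (at_left 1) sequentially"
        using S by (intro filterlim_at_withinI) (auto intro: less_imp_neq)
      from filterlim_compose[OF w(2) this]
      have "(\<lambda>n. 1 - (cmod (\<theta> (of_real (S n) * \<xi>)))\<^sup>2) \<longlonglongrightarrow> 1 - (cmod w)\<^sup>2"
        by (intro tendsto_intros)
      then show ?case using inb[OF elim(2)] w(1) by (simp del: mem_ball)
    qed
    show "AE \<xi> in circle_measure. norm (1 - (cmod (\<theta> (of_real (S n) * \<xi>) * indicator (ball 0 1) (of_real (S n) * \<xi>)))\<^sup>2) \<le> 1" for n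
      using AE_circle
    proof eventually_elim
      case (elim \<xi>)
      have "cmod (\<theta> (of_real (S n) * \<xi>)) \<le> 1"
        using \<theta> inb[OF elim] by (auto simp: inner_function_def)
      then have "(cmod (\<theta> (of_real (S n) * \<xi>)))\<^sup>2 \<le> 1" by (simp add: power_le_one)
      then show ?case using inb[OF elim] by (simp del: mem_ball)
    qed
  qed simp_all
  then show "(\<lambda>n. W (S n)) \<longlonglongrightarrow> 0" by simp
qed simp

text \<open>At radius \<open>r\<close>, the two sides differ by the integral of \<open>(1 - |\<theta>|\<^sup>2) * f * cnj g\<close>. Here \<open>f\<close> is bounded,
  \<open>g\<close> is bounded in square mean, and the square mean of \<open>1 - |\<theta>|\<^sup>2\<close> tends to zero; so the difference
  vanishes in the limit by an arithmetic-geometric mean estimate with weight \<open>t\<close>.\<close>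

lemma inner_mult_isometry:
  assumes \<theta>: "inner_function \<theta>" and f: "disc_function f" "\<And>z. z \<in> ball 0 1 \<Longrightarrow> cmod (f z) \<le> B"
    and g: "g \<in> hardy2"
  shows "hardy_inner (\<lambda>z. \<theta> z * f z) (\<lambda>z. \<theta> z * g z) = hardy_inner f g"
proof (rule hardy_innerI)
  define \<theta>0 where "\<theta>0 = (\<lambda>z. \<theta> z * indicator (ball 0 1) z)"
  have d0: "disc_function \<theta>0"
    using \<theta> unfolding disc_function_def inner_function_def \<theta>0_def
    by (auto intro!: holomorphic_transform[of \<theta>])
  have le0: "cmod (\<theta>0 z) \<le> 1" for z
    using \<theta> by (auto simp: \<theta>0_def inner_function_def indicator_def)
  define W where "W = (\<lambda>r::real. LINT \<xi>|circle_measure. 1 - (cmod (\<theta>0 (of_real r * \<xi>)))\<^sup>2)"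
  have W: "(W \<longlongrightarrow> 0) (at_left 1)"
    using inner_function_defect_tendsto[OF \<theta>] by (simp add: W_def \<theta>0_def)
  note dg = hardy2_disc_function[OF g]
  note [measurable] = disc_function_borel[OF d0] disc_function_borel[OF f(1)] disc_function_borel[OF dg]
  have fh: "f \<in> hardy2" by (rule hardy2_bounded[OF f])
  have B: "0 \<le> B" using f(2)[of 0] norm_ge_zero[of "f 0"] by (simp del: norm_ge_zero)
  obtain M where M: "\<And>r. 0 \<le> r \<Longrightarrow> r < 1 \<Longrightarrow> (LINT \<xi>|circle_measure. (cmod (g (of_real r * \<xi>)))\<^sup>2) \<le> M"
    using hardy2_square_bound[OF g] by blast
  have Wint: "integrable circle_measure (\<lambda>\<xi>. 1 - (cmod (\<theta>0 (of_real r * \<xi>)))\<^sup>2)" for r :: real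
  proof (rule circle.integrable_const_bound[of _ 1])
    have "(cmod (\<theta>0 z))\<^sup>2 \<le> 1" for z using le0 by (simp add: power_le_one)
    then show "AE \<xi> in circle_measure. norm (1 - (cmod (\<theta>0 (of_real r * \<xi>)))\<^sup>2) \<le> 1" by simp
  qed simp
  have W0: "0 \<le> W r" for r
    unfolding W_def using le0 by (intro integral_nonneg_AE) (simp add: power_le_one)
  \<comment> \<open>The weight \<open>t\<close> balances the two terms; the summand \<open>1 - r\<close> keeps it positive.\<close>
  define t where "t = (\<lambda>r. sqrt (W r) + (1 - r))"
  have bound: "cmod (circle_pairing r (\<lambda>z. \<theta> z * f z) (\<lambda>z. \<theta> z * g z) - circle_pairing r f g)
      \<le> B * (sqrt (W r) + t r * M)" if r: "0 \<le> r" "r < 1" for r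
  proof -
    have t: "0 < t r" using W0[of r] r by (simp add: t_def add_nonneg_pos)
    let ?\<theta> = "\<lambda>\<xi>. \<theta>0 (of_real r * \<xi>)" and ?f = "\<lambda>\<xi>. f (of_real r * \<xi>)" and ?g = "\<lambda>\<xi>. g (of_real r * \<xi>)"
    have th: "\<theta> z * f z = \<theta>0 z * f z" "\<theta> z * g z = \<theta>0 z * g z" for z
      using f(1) dg by (auto simp: \<theta>0_def disc_function_def indicator_def)
    have d1: "disc_function (\<lambda>z. \<theta>0 z * f z)" "disc_function (\<lambda>z. \<theta>0 z * g z)"
      using inner_mult_disc_function[OF \<theta> f(1)] inner_mult_disc_function[OF \<theta> dg] by (simp_all add: th)
    have diff: "circle_pairing r (\<lambda>z. \<theta> z * f z) (\<lambda>z. \<theta> z * g z) - circle_pairing r f g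
       = (LINT \<xi>|circle_measure. (?\<theta> \<xi> * ?f \<xi>) * cnj (?\<theta> \<xi> * ?g \<xi>) - ?f \<xi> * cnj (?g \<xi>))"
      unfolding circle_pairing_def th
      by (rule Bochner_Integration.integral_diff[symmetric])
        (use circle_pairing_integrable[OF d1 r] circle_pairing_integrable[OF f(1) dg r] in auto)
    have "cmod (circle_pairing r (\<lambda>z. \<theta> z * f z) (\<lambda>z. \<theta> z * g z) - circle_pairing r f g)
       \<le> (LINT \<xi>|circle_measure. B * ((1 - (cmod (?\<theta> \<xi>))\<^sup>2) / t r + t r * (cmod (?g \<xi>))\<^sup>2))"
      unfolding diff
    proof (rule Bochner_Integration.integral_norm_bound_integral)
      show "integrable circle_measure (\<lambda>\<xi>. (?\<theta> \<xi> * ?f \<xi>) * cnj (?\<theta> \<xi> * ?g \<xi>) - ?f \<xi> * cnj (?g \<xi>))"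
        using circle_pairing_integrable[OF d1 r] circle_pairing_integrable[OF f(1) dg r]
        by (rule Bochner_Integration.integrable_diff)
      show "integrable circle_measure (\<lambda>\<xi>. B * ((1 - (cmod (?\<theta> \<xi>))\<^sup>2) / t r + t r * (cmod (?g \<xi>))\<^sup>2))"
        using Wint[of r] circle_square_integrable[OF dg r]
        by (intro integrable_mult_right Bochner_Integration.integrable_add integrable_divide) auto
      fix \<xi>
      define p where "p = 1 - (cmod (?\<theta> \<xi>))\<^sup>2"
      have p: "0 \<le> p" "p \<le> 1" using le0[of "of_real r * \<xi>"] by (auto simp: p_def power_le_one)
      have fB: "cmod (?f \<xi>) \<le> B"
        using f B by (cases "of_real r * \<xi> \<in> ball 0 1") (auto simp: disc_function_def)
      have "(?\<theta> \<xi> * ?f \<xi>) * cnj (?\<theta> \<xi> * ?g \<xi>) - ?f \<xi> * cnj (?g \<xi>) = - (of_real p * (?f \<xi> * cnj (?g \<xi>)))"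
        unfolding p_def of_real_diff complex_norm_square by (simp add: algebra_simps)
      then have "cmod ((?\<theta> \<xi> * ?f \<xi>) * cnj (?\<theta> \<xi> * ?g \<xi>) - ?f \<xi> * cnj (?g \<xi>)) = cmod (?f \<xi>) * (p * cmod (?g \<xi>))"
        using p by (simp add: norm_mult mult_ac)
      also have "\<dots> \<le> B * (p * cmod (?g \<xi>))"
        using fB p by (intro mult_right_mono) auto
      also have "\<dots> \<le> B * (p / t r + t r * (cmod (?g \<xi>))\<^sup>2)"
      proof (intro mult_left_mono B)
        have "2 * (p * (t r * cmod (?g \<xi>))) \<le> p\<^sup>2 + (t r * cmod (?g \<xi>))\<^sup>2"
          using sum_squares_bound[of p "t r * cmod (?g \<xi>)"] by (simp add: mult_ac)
        moreover have "p\<^sup>2 \<le> p" using p by (simp add: power2_eq_square mult_left_le)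
        moreover have "0 \<le> p * (t r * cmod (?g \<xi>))" using p t by simp
        ultimately have "p * cmod (?g \<xi>) * t r \<le> p + (t r * cmod (?g \<xi>))\<^sup>2" by (simp add: mult_ac)
        then have "p * cmod (?g \<xi>) \<le> (p + (t r * cmod (?g \<xi>))\<^sup>2) / t r"
          using t by (simp add: pos_le_divide_eq)
        also have "\<dots> = p / t r + t r * (cmod (?g \<xi>))\<^sup>2"
          using t by (simp add: field_simps power2_eq_square)
        finally show "p * cmod (?g \<xi>) \<le> p / t r + t r * (cmod (?g \<xi>))\<^sup>2" .
      qed
      finally show "cmod ((?\<theta> \<xi> * ?f \<xi>) * cnj (?\<theta> \<xi> * ?g \<xi>) - ?f \<xi> * cnj (?g \<xi>))
        \<le> B * ((1 - (cmod (?\<theta> \<xi>))\<^sup>2) / t r + t r * (cmod (?g \<xi>))\<^sup>2)"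
        by (simp only: p_def)
    qed
    also have "\<dots> = B * (W r / t r + t r * (LINT \<xi>|circle_measure. (cmod (?g \<xi>))\<^sup>2))"
    proof -
      have "(LINT \<xi>|circle_measure. (1 - (cmod (?\<theta> \<xi>))\<^sup>2) / t r + t r * (cmod (?g \<xi>))\<^sup>2)
        = (LINT \<xi>|circle_measure. (1 - (cmod (?\<theta> \<xi>))\<^sup>2) / t r) + (LINT \<xi>|circle_measure. t r * (cmod (?g \<xi>))\<^sup>2)"
        using Wint[of r] circle_square_integrable[OF dg r]
        by (intro Bochner_Integration.integral_add) auto
      then show ?thesis
        by (simp only: integral_mult_right_zero integral_divide_zero W_def)
    qed
    also have "\<dots> \<le> B * (sqrt (W r) + t r * M)"
    proof (intro mult_left_mono add_mono B)
      have "W r = sqrt (W r) * sqrt (W r)" using W0[of r] by simp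
      also have "\<dots> \<le> sqrt (W r) * t r" using W0[of r] r by (intro mult_left_mono) (auto simp: t_def)
      finally show "W r / t r \<le> sqrt (W r)" using t by (simp add: divide_le_eq)
    qed (use M[OF r] t in auto)
    finally show ?thesis .
  qed
  have tl: "((\<lambda>r. B * (sqrt (W r) + t r * M)) \<longlongrightarrow> 0) (at_left 1)"
    unfolding t_def by (rule tendsto_eq_intros W refl | simp)+
  have "((\<lambda>r. circle_pairing r (\<lambda>z. \<theta> z * f z) (\<lambda>z. \<theta> z * g z) - circle_pairing r f g) \<longlongrightarrow> 0) (at_left 1)"
    by (rule Lim_null_comparison[OF eventually_mono[OF eventually_radius] tl]) (use bound in auto)
  from tendsto_add[OF this hardy_inner_tendsto[OF fh g]]
  show "((\<lambda>r. circle_pairing r (\<lambda>z. \<theta> z * f z) (\<lambda>z. \<theta> z * g z)) \<longlongrightarrow> hardy_inner f g) (at_left 1)"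
    by simp
qed

lemma model_kernel_eq:
  "model_kernel \<theta> w = (\<lambda>z. cauchy_kernel w z + - cnj (\<theta> w) * (\<theta> z * cauchy_kernel w z))"
  by (auto simp: model_kernel_def cauchy_kernel_def diff_divide_distrib)

context
  fixes \<theta> :: "complex \<Rightarrow> complex"
  assumes \<theta>: "inner_function \<theta>"
begin

lemma model_kernel_hardy2: "w \<in> ball 0 1 \<Longrightarrow> model_kernel \<theta> w \<in> hardy2"
  unfolding model_kernel_eq
  by (intro hardy2_add_scaled inner_mult_hardy2 \<theta> cauchy_kernel_hardy2)

text \<open>The inner product with \<open>\<theta> g\<close> is a difference of two terms, both equal to \<open>cnj (\<theta> w * g w)\<close>: the
  first by the reproducing property of the Cauchy kernel, the second once \<open>\<theta>\<close> is removed from both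
  factors.\<close>

lemma model_kernel_in_model_space:
  assumes w: "w \<in> ball 0 1"
  shows "model_kernel \<theta> w \<in> model_space \<theta>"
proof -
  have "hardy_inner (model_kernel \<theta> w) (\<lambda>z. \<theta> z * g z) = 0" if g: "g \<in> hardy2" for g
  proof -
    note ck = cauchy_kernel_hardy2[OF w]
    note tg = inner_mult_hardy2[OF \<theta> g]
    have "hardy_inner (model_kernel \<theta> w) (\<lambda>z. \<theta> z * g z) =
       hardy_inner (cauchy_kernel w) (\<lambda>z. \<theta> z * g z) +
       - cnj (\<theta> w) * hardy_inner (\<lambda>z. \<theta> z * cauchy_kernel w z) (\<lambda>z. \<theta> z * g z)"
      unfolding model_kernel_eq by (intro hardy_inner_add_scaled inner_mult_hardy2 \<theta> ck g)
    also have "hardy_inner (\<lambda>z. \<theta> z * cauchy_kernel w z) (\<lambda>z. \<theta> z * g z) = hardy_inner (cauchy_kernel w) g"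
      by (rule inner_mult_isometry[OF \<theta> disc_function_cauchy_kernel[OF w] cauchy_kernel_bound[OF w] g])
    also have "hardy_inner (cauchy_kernel w) g = cnj (g w)"
      using hardy_inner_cnj[OF g ck] hardy_inner_cauchy_kernel[OF g w] by simp
    also have "hardy_inner (cauchy_kernel w) (\<lambda>z. \<theta> z * g z) = cnj (\<theta> w * g w)"
      using hardy_inner_cnj[OF tg ck] hardy_inner_cauchy_kernel[OF tg w] by simp
    finally show ?thesis by simp
  qed
  then show ?thesis using model_kernel_hardy2[OF w] by (simp add: model_space_def)
qed

text \<open>The kernel differs from the Cauchy kernel by a multiple of \<open>\<theta>\<close>, to which \<open>f\<close> is orthogonal.\<close>

lemma model_kernel_reproduces:
  assumes f: "f \<in> model_space \<theta>" and w: "w \<in> ball 0 1"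
  shows "hardy_inner f (model_kernel \<theta> w) = f w"
proof -
  have fh: "f \<in> hardy2" using f by (simp add: model_space_def)
  note ck = cauchy_kernel_hardy2[OF w]
  note tck = inner_mult_hardy2[OF \<theta> ck]
  have "hardy_inner (model_kernel \<theta> w) f = hardy_inner (cauchy_kernel w) f +
      - cnj (\<theta> w) * hardy_inner (\<lambda>z. \<theta> z * cauchy_kernel w z) f"
    unfolding model_kernel_eq by (intro hardy_inner_add_scaled tck ck fh)
  also have "hardy_inner (cauchy_kernel w) f = cnj (f w)"
    using hardy_inner_cnj[OF fh ck] hardy_inner_cauchy_kernel[OF fh w] by simp
  also have "hardy_inner (\<lambda>z. \<theta> z * cauchy_kernel w z) f = 0"
    using hardy_inner_cnj[OF fh tck] f ck by (simp add: model_space_def)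
  finally show ?thesis
    using hardy_inner_cnj[OF model_kernel_hardy2[OF w] fh] by simp
qed

lemma model_kernel_gram:
  assumes "v \<in> ball 0 1" "w \<in> ball 0 1"
  shows "hardy_inner (model_kernel \<theta> v) (model_kernel \<theta> w) = model_kernel \<theta> v w"
  by (intro model_kernel_reproduces model_kernel_in_model_space assms)

end

lemma model_space_scale:
  assumes "f \<in> model_space \<theta>" and \<theta>: "inner_function \<theta>"
  shows "(\<lambda>z. c * f z) \<in> model_space \<theta>"
proof -
  have f: "f \<in> hardy2" "\<And>g. g \<in> hardy2 \<Longrightarrow> hardy_inner f (\<lambda>z. \<theta> z * g z) = 0"
    using assms by (auto simp: model_space_def)
  have "hardy_inner (\<lambda>z. 0 + c * f z) (\<lambda>z. \<theta> z * g z) = 0" if "g \<in> hardy2" for g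
    using hardy_inner_add_scaled[OF hardy2_zero f(1) inner_mult_hardy2[OF \<theta> that], of c] f(2)[OF that]
      hardy_inner_zero by simp
  then show ?thesis using f(1) by (simp add: model_space_def hardy2_scale)
qed

text \<open>The squared norm of the kernel at \<open>w\<close>.\<close>

definition kernel_square :: "(complex \<Rightarrow> complex) \<Rightarrow> complex \<Rightarrow> real" where
  "kernel_square \<theta> w = (1 - (cmod (\<theta> w))\<^sup>2) / (1 - (cmod w)\<^sup>2)"

lemma model_kernel_diagonal:
  assumes "w \<in> ball 0 1"
  shows "model_kernel \<theta> w w = of_real (kernel_square \<theta> w)"
proof -
  have *: "cnj z * z = of_real ((cmod z)\<^sup>2)" for z
    unfolding complex_norm_square by (rule mult.commute)
  show ?thesis using assms unfolding model_kernel_def kernel_square_def * by simp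
qed

lemma model_kernel_norm_square:
  assumes "inner_function \<theta>" "w \<in> ball 0 1"
  shows "(hardy_norm (model_kernel \<theta> w))\<^sup>2 = kernel_square \<theta> w"
  using hardy_norm_square[OF model_kernel_hardy2[OF assms]] model_kernel_gram[OF assms(1,2,2)]
    model_kernel_diagonal[OF assms(2), of \<theta>] by simp

section \<open>Sequences whose Gram matrix is nearly constant off the diagonal\<close>

text \<open>Let \<open>s\<close> be the sum of the \<open>d\<^sub>i\<close> and \<open>v\<close> that of the \<open>d\<^sub>i * u\<^sub>i\<close>. The constant part of \<open>G\<close>
  contributes \<open>|s|\<^sup>2 / 2\<close>, the part with \<open>u\<close> contributes \<open>2 * Re (v * cnj s)\<close>, and the diagonal excess
  contributes about half of the square sum of \<open>d\<close>. The terms \<open>u\<^sub>i + cnj (u\<^sub>j)\<close> do not decay in the two indices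
  jointly, so they are no summable error; they are harmless because the positive term \<open>|s|\<^sup>2 / 2\<close>
  absorbs them, which is why they appear separately in the hypothesis.\<close>

lemma nearly_constant_gram_lower_bound:
  fixes d u :: "nat \<Rightarrow> complex" and G :: "nat \<Rightarrow> nat \<Rightarrow> complex"
  assumes M: "finite M"
    and u: "\<And>i. cmod (u i) \<le> 1/32 * (1/4) ^ i"
    and diag: "\<And>i. G i i = 1"
    and off: "\<And>i j. i \<noteq> j \<Longrightarrow> cmod (G i j - (1/2 + u i + cnj (u j))) \<le> 1/16 * (1/2) ^ (i + j)"
  shows "1/4 * (\<Sum>i\<in>M. (cmod (d i))\<^sup>2) \<le> Re (\<Sum>i\<in>M. \<Sum>j\<in>M. d i * cnj (d j) * G i j)"
proof -
  define E where "E = (\<lambda>i j. G i j - (1/2 + u i + cnj (u j)) - (if i = j then 1/2 else 0))"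
  have E: "cmod (E i j) \<le> 1/16 * ((1/2) ^ i * (1/2) ^ j)" for i j
  proof (cases "i = j")
    case True
    have "E i j = - of_real (2 * Re (u i))"
      using True diag[of i] by (simp add: E_def complex_eq_iff)
    then have "cmod (E i j) = 2 * \<bar>Re (u i)\<bar>" by (simp add: norm_mult)
    also have "\<dots> \<le> 2 * (1/32 * (1/4) ^ i)"
      using order_trans[OF abs_Re_le_cmod u] by (intro mult_left_mono) auto
    also have "(1/4 :: real) ^ i = (1/2) ^ i * (1/2) ^ j"
      using True by (simp add: power_mult_distrib[symmetric])
    finally show ?thesis by simp
  qed (use off[of i j] in \<open>simp add: E_def power_add\<close>)
  define s v where "s = (\<Sum>i\<in>M. d i)" and "v = (\<Sum>i\<in>M. d i * u i)"
  define D P where "D = (\<Sum>i\<in>M. (cmod (d i))\<^sup>2)" and "P = (\<Sum>i\<in>M. (1/2) ^ i * cmod (d i))"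
  define R where "R = (\<Sum>i\<in>M. \<Sum>j\<in>M. d i * cnj (d j) * E i j)"
  have P0: "0 \<le> P" and D0: "0 \<le> D" unfolding P_def D_def by (auto intro!: sum_nonneg)
  have "P\<^sup>2 \<le> (\<Sum>i\<in>M. ((1/2 :: real) ^ i)\<^sup>2) * (\<Sum>i\<in>M. (cmod (d i))\<^sup>2)"
    unfolding P_def by (rule Cauchy_Schwarz_ineq_sum)
  also have "(\<Sum>i\<in>M. ((1/2 :: real) ^ i)\<^sup>2) = (\<Sum>i\<in>M. (1/4) ^ i)"
    by (simp add: power2_eq_square flip: power_mult_distrib)
  also have "(\<Sum>i\<in>M. (1/4 :: real) ^ i) \<le> (\<Sum>i. (1/4) ^ i)"
    by (rule sum_le_suminf) (use M in \<open>auto intro: summable_geometric\<close>)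
  also have "\<dots> = 4/3" by (subst suminf_geometric) auto
  finally have P2: "P\<^sup>2 \<le> 4/3 * D" using D0 by (simp add: D_def mult_right_mono)
  have v: "cmod v \<le> 1/32 * P"
  proof -
    have "cmod (d i * u i) \<le> 1/32 * ((1/2) ^ i * cmod (d i))" for i
    proof -
      have "cmod (u i) \<le> 1/32 * (1/2) ^ i"
        using u[of i] power_mono[of "1/4" "1/2 :: real" i] by simp
      then have "cmod (d i) * cmod (u i) \<le> cmod (d i) * (1/32 * (1/2) ^ i)"
        by (rule mult_left_mono) simp
      then show ?thesis by (simp add: norm_mult mult_ac)
    qed
    then show ?thesis
      unfolding v_def P_def sum_distrib_left by (intro sum_norm_le) auto
  qed
  have R: "cmod R \<le> 1/16 * P\<^sup>2"
  proof -
    have "cmod (d i * cnj (d j) * E i j) \<le> 1/16 * (((1/2) ^ i * cmod (d i)) * ((1/2) ^ j * cmod (d j)))" for i j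
      using mult_left_mono[OF E[of i j], of "cmod (d i) * cmod (d j)"] by (simp add: norm_mult mult_ac)
    then have "cmod R \<le> (\<Sum>i\<in>M. \<Sum>j\<in>M. 1/16 * (((1/2) ^ i * cmod (d i)) * ((1/2) ^ j * cmod (d j))))"
      unfolding R_def by (intro sum_norm_le) auto
    moreover have "P\<^sup>2 = (\<Sum>i\<in>M. \<Sum>j\<in>M. ((1/2) ^ i * cmod (d i)) * ((1/2) ^ j * cmod (d j)))"
      by (simp only: P_def power2_eq_square sum_product)
    ultimately show ?thesis by (simp only: sum_distrib_left)
  qed
  have entry: "d i * cnj (d j) * G i j = 1/2 * (d i * cnj (d j)) + (d i * u i) * cnj (d j)
      + d i * cnj (d j * u j) + (if i = j then of_real ((cmod (d i))\<^sup>2) / 2 else 0) + d i * cnj (d j) * E i j" for i j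
    by (simp add: E_def complex_norm_square algebra_simps del: of_real_power)
  have sum_eq: "(\<Sum>i\<in>M. \<Sum>j\<in>M. d i * cnj (d j) * G i j) =
      1/2 * (s * cnj s) + v * cnj s + s * cnj v + of_real D / 2 + R"
  proof -
    have "(\<Sum>i\<in>M. \<Sum>j\<in>M. 1/2 * (d i * cnj (d j))) = 1/2 * (s * cnj s)"
      by (simp only: s_def cnj_sum sum_product) (simp only: sum_distrib_left)
    moreover have "(\<Sum>i\<in>M. \<Sum>j\<in>M. (d i * u i) * cnj (d j)) = v * cnj s"
      by (simp only: s_def v_def cnj_sum sum_product)
    moreover have "(\<Sum>i\<in>M. \<Sum>j\<in>M. d i * cnj (d j * u j)) = s * cnj v"
      by (simp only: s_def v_def cnj_sum sum_product)
    moreover have "(\<Sum>i\<in>M. \<Sum>j\<in>M. if i = j then complex_of_real ((cmod (d i))\<^sup>2) / 2 else 0) = of_real D / 2"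
      using M by (simp add: D_def sum_divide_distrib)
    ultimately show ?thesis
      unfolding entry sum.distrib R_def[symmetric] by (simp only:)
  qed
  have "Re (\<Sum>i\<in>M. \<Sum>j\<in>M. d i * cnj (d j) * G i j) =
      (cmod s)\<^sup>2 / 2 + 2 * Re (v * cnj s) + D / 2 + Re R"
  proof -
    have "s * cnj s = of_real ((cmod s)\<^sup>2)" by (simp only: complex_norm_square)
    moreover have "Re (s * cnj v) = Re (v * cnj s)" by simp
    ultimately show ?thesis using sum_eq by simp
  qed
  moreover have "- (1/32 * P * cmod s) \<le> Re (v * cnj s)"
  proof -
    have "cmod (v * cnj s) \<le> 1/32 * P * cmod s"
      using mult_right_mono[OF v, of "cmod s"] by (simp add: norm_mult)
    then show ?thesis using abs_Re_le_cmod[of "v * cnj s"] by linarith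
  qed
  moreover have "- (1/16 * P\<^sup>2) \<le> Re R"
    using abs_Re_le_cmod[of R] R by linarith
  moreover have "P * cmod s \<le> P\<^sup>2 + (cmod s)\<^sup>2"
    using sum_squares_bound[of P "cmod s"] P0 mult_nonneg_nonneg[OF P0 norm_ge_zero[of s]] by linarith
  moreover have "0 \<le> (cmod s)\<^sup>2" by simp
  ultimately show ?thesis using P2 D0 unfolding D_def[symmetric] by linarith
qed

lemma lin_span_subset_hardy2: "S \<subseteq> hardy2 \<Longrightarrow> lin_span S \<subseteq> hardy2"
  unfolding lin_span_def by (auto intro!: hardy2_sum)

lemma zero_in_lin_span: "(\<lambda>z. 0) \<in> lin_span S"
  unfolding lin_span_def by (rule CollectI, rule exI[of _ "{}"]) auto

lemma lin_span_add:
  assumes "f \<in> lin_span S" "g \<in> lin_span S"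
  shows "(\<lambda>z. f z + g z) \<in> lin_span S"
proof -
  from assms obtain F c F' c' where F: "finite F" "F \<subseteq> S" "f = (\<lambda>z. \<Sum>h\<in>F. c h * h z)"
    and F': "finite F'" "F' \<subseteq> S" "g = (\<lambda>z. \<Sum>h\<in>F'. c' h * h z)"
    unfolding lin_span_def by blast
  define d where "d = (\<lambda>h. (if h \<in> F then c h else 0) + (if h \<in> F' then c' h else 0))"
  have "f z + g z = (\<Sum>h\<in>F \<union> F'. d h * h z)" for z
  proof -
    have "f z = (\<Sum>h\<in>F \<union> F'. (if h \<in> F then c h else 0) * h z)"
      unfolding F(3) using F(1) F'(1) by (intro sum.mono_neutral_cong_left) auto
    moreover have "g z = (\<Sum>h\<in>F \<union> F'. (if h \<in> F' then c' h else 0) * h z)"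
      unfolding F'(3) using F(1) F'(1) by (intro sum.mono_neutral_cong_left) auto
    ultimately show ?thesis by (simp add: d_def distrib_right sum.distrib)
  qed
  then show ?thesis
    unfolding lin_span_def using F F' by (intro CollectI exI[of _ "F \<union> F'"] exI[of _ d]) auto
qed

lemma closed_lin_span_add:
  assumes S: "S \<subseteq> hardy2" and f: "f \<in> closed_lin_span S" and g: "g \<in> closed_lin_span S"
  shows "(\<lambda>z. f z + g z) \<in> closed_lin_span S"
proof -
  have fg: "f \<in> hardy2" "g \<in> hardy2" using f g by (auto simp: closed_lin_span_def)
  have "\<exists>h\<in>lin_span S. hardy_norm (\<lambda>z. f z + g z - h z) < \<epsilon>" if "\<epsilon> > 0" for \<epsilon>
  proof -
    have half: "0 < \<epsilon>/2" using that by simp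
    obtain h where h: "h \<in> lin_span S" "hardy_norm (\<lambda>z. f z - h z) < \<epsilon>/2"
      using f half unfolding closed_lin_span_def by blast
    obtain k where k: "k \<in> lin_span S" "hardy_norm (\<lambda>z. g z - k z) < \<epsilon>/2"
      using g half unfolding closed_lin_span_def by blast
    have "h \<in> hardy2" "k \<in> hardy2" using h k lin_span_subset_hardy2[OF S] by auto
    then have "hardy_norm (\<lambda>z. (f z - h z) + (g z - k z)) \<le>
        hardy_norm (\<lambda>z. f z - h z) + hardy_norm (\<lambda>z. g z - k z)"
      by (rule hardy_norm_triangle[OF hardy2_diff[OF fg(1)] hardy2_diff[OF fg(2)]])
    then have "hardy_norm (\<lambda>z. (f z - h z) + (g z - k z)) < \<epsilon>"
      using h(2) k(2) by linarith
    moreover have "(\<lambda>z. (f z - h z) + (g z - k z)) = (\<lambda>z. f z + g z - (h z + k z))"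
      by (simp add: algebra_simps)
    ultimately have "hardy_norm (\<lambda>z. f z + g z - (h z + k z)) < \<epsilon>" by simp
    then show ?thesis using lin_span_add[OF h(1) k(1)] by (rule bexI)
  qed
  then show ?thesis unfolding closed_lin_span_def using hardy2_add[OF fg] by simp
qed

lemma hardy_norm_zero: "hardy_norm (\<lambda>z. 0) = 0"
  by (simp add: hardy_norm_def hardy_inner_zero)

lemma hardy_dist_closed_lin_span_ge:
  assumes S: "S \<subseteq> hardy2" and f: "f \<in> hardy2"
    and ge: "\<And>h. h \<in> lin_span S \<Longrightarrow> \<delta> \<le> hardy_norm (\<lambda>z. f z - h z)"
  shows "\<delta> \<le> hardy_dist f (closed_lin_span S)"
  unfolding hardy_dist_def
proof (rule cINF_greatest)
  have "(\<lambda>z. 0) \<in> closed_lin_span S"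
    unfolding closed_lin_span_def using zero_in_lin_span[of S] hardy_norm_zero
    by (auto simp: hardy2_zero intro!: bexI[of _ "\<lambda>z. 0"])
  then show "closed_lin_span S \<noteq> {}" by blast
  fix g assume g: "g \<in> closed_lin_span S"
  have g2: "g \<in> hardy2" using g by (simp add: closed_lin_span_def)
  show "\<delta> \<le> hardy_norm (\<lambda>z. f z - g z)"
  proof (rule field_le_epsilon)
    fix e :: real assume "e > 0"
    then obtain h where h: "h \<in> lin_span S" "hardy_norm (\<lambda>z. g z - h z) < e"
      using g unfolding closed_lin_span_def by blast
    have "h \<in> hardy2" using h(1) lin_span_subset_hardy2[OF S] by auto
    then have "hardy_norm (\<lambda>z. (f z - g z) + (g z - h z)) \<le> hardy_norm (\<lambda>z. f z - g z) + hardy_norm (\<lambda>z. g z - h z)"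
      by (intro hardy_norm_triangle hardy2_diff f g2)
    then show "\<delta> \<le> hardy_norm (\<lambda>z. f z - g z) + e" using ge[OF h(1)] h(2) by simp
  qed
qed

text \<open>The difference of \<open>x\<^sub>n\<close> and a combination of the other vectors is a combination with coefficient \<open>1\<close>
  at \<open>n\<close>, so its squared norm is at least \<open>c\<close>.\<close>

lemma uniformly_minimal_if_gram_bounded_below:
  assumes x: "\<And>n. x n \<in> hardy2" and c: "0 < c"
    and lower: "\<And>M d. finite M \<Longrightarrow>
       c * (\<Sum>i\<in>M. (cmod (d i))\<^sup>2) \<le> (hardy_norm (\<lambda>z. \<Sum>i\<in>M. d i * x i z))\<^sup>2"
  shows "uniformly_minimal x"
proof -
  have "sqrt c \<le> hardy_dist (x n) (closed_lin_span (x ` {m. m \<noteq> n}))" for n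
  proof (rule hardy_dist_closed_lin_span_ge)
    fix h assume "h \<in> lin_span (x ` {m. m \<noteq> n})"
    then obtain F a where F: "finite F" "F \<subseteq> x ` {m. m \<noteq> n}" "h = (\<lambda>z. \<Sum>f\<in>F. a f * f z)"
      unfolding lin_span_def by blast
    then obtain M where M: "M \<subseteq> {m. m \<noteq> n}" "inj_on x M" "F = x ` M"
      by (meson subset_image_inj)
    have fin: "finite M" using F(1) M finite_imageD by blast
    have n: "n \<notin> M" using M(1) by blast
    define d where "d = (\<lambda>i. if i = n then 1 else - a (x i))"
    have "x n z - h z = (\<Sum>i\<in>insert n M. d i * x i z)" for z
    proof -
      have "(\<Sum>i\<in>M. d i * x i z) = (\<Sum>i\<in>M. - (a (x i) * x i z))"
        using n by (intro sum.cong) (auto simp: d_def)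
      then show ?thesis
        using fin n M(2) by (simp add: F(3) M(3) sum.reindex sum_negf d_def)
    qed
    moreover have "c * 1 \<le> c * (\<Sum>i\<in>insert n M. (cmod (d i))\<^sup>2)"
      using c fin n by (intro mult_left_mono) (auto simp: d_def intro!: sum_nonneg)
    ultimately have "c \<le> (hardy_norm (\<lambda>z. x n z - h z))\<^sup>2"
      using lower[of "insert n M" d] fin by simp
    moreover have "h \<in> hardy2" unfolding F(3) using F(2) x by (intro hardy2_sum) auto
    ultimately show "sqrt c \<le> hardy_norm (\<lambda>z. x n z - h z)"
      by (intro real_le_lsqrt hardy_norm_nonneg hardy2_diff x) auto
  qed (use x in auto)
  then have "sqrt c \<le> (INF n. hardy_dist (x n) (closed_lin_span (x ` {m. m \<noteq> n})))"
    by (intro cINF_greatest) auto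
  then show ?thesis
    using c unfolding uniformly_minimal_def by (simp add: less_le_trans[OF real_sqrt_gt_zero])
qed

text \<open>The sum is the image of a sum of \<open>N\<close> orthonormal vectors under a bounded operator.\<close>

lemma riesz_sequence_sum_bound:
  assumes y: "\<And>n. y n \<in> hardy2" and "riesz_sequence y"
  obtains C where "\<And>N. (hardy_norm (\<lambda>z. \<Sum>n<N. y n z))\<^sup>2 \<le> C * real N"
proof -
  define H where "H = closed_lin_span (range y)"
  from assms(2) obtain e T where e: "orthonormal_basis H e" and T: "linear_isomorphism H T"
    and yT: "\<And>n. y n = T (e n)"
    unfolding riesz_sequence_def riesz_basis_def H_def by blast
  have eH: "e n \<in> H" for n using e by (simp add: orthonormal_basis_def)
  have e2: "e n \<in> hardy2" for n using eH by (simp add: H_def closed_lin_span_def)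
  obtain C where C: "\<And>f. f \<in> H \<Longrightarrow> hardy_norm (T f) \<le> C * hardy_norm f"
    using T unfolding linear_isomorphism_def by blast
  have sums: "(\<lambda>z. \<Sum>n<N. e n z) \<in> H \<and> T (\<lambda>z. \<Sum>n<N. e n z) = (\<lambda>z. \<Sum>n<N. y n z)" for N
  proof (induction N)
    case 0
    have "(\<lambda>z. 0) \<in> H"
      unfolding H_def closed_lin_span_def using zero_in_lin_span hardy_norm_zero
      by (auto simp: hardy2_zero intro!: bexI[of _ "\<lambda>z. 0"])
    moreover have "T (\<lambda>z. 0 * e 0 z) = (\<lambda>z. 0 * T (e 0) z)"
      using T eH unfolding linear_isomorphism_def by blast
    ultimately show ?case by simp
  next
    case (Suc N)
    have "(\<lambda>z. (\<Sum>n<N. e n z) + e N z) \<in> H"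
      using Suc eH y unfolding H_def by (intro closed_lin_span_add) auto
    moreover have "T (\<lambda>z. (\<Sum>n<N. e n z) + e N z) = (\<lambda>z. T (\<lambda>z. \<Sum>n<N. e n z) z + T (e N) z)"
      using T conjunct1[OF Suc] eH[of N] unfolding linear_isomorphism_def by auto
    ultimately show ?case using Suc by (simp add: yT)
  qed
  have "(hardy_norm (\<lambda>z. \<Sum>n<N. y n z))\<^sup>2 \<le> C\<^sup>2 * real N" for N
  proof -
    have "hardy_inner (\<lambda>z. \<Sum>n<N. 1 * e n z) (\<lambda>z. \<Sum>n<N. 1 * e n z) =
        (\<Sum>i<N. \<Sum>j<N. 1 * cnj 1 * hardy_inner (e i) (e j))"
      by (rule hardy_inner_sum_sum[OF e2])
    also have "\<dots> = (\<Sum>i<N. \<Sum>j<N. if i = j then 1 else 0)"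
      using e by (simp add: orthonormal_basis_def)
    also have "\<dots> = of_nat N" by simp
    finally have "(hardy_norm (\<lambda>z. \<Sum>n<N. e n z))\<^sup>2 = real N"
      using hardy_norm_square[OF hardy2_sum[of "{..<N}" e "\<lambda>_. 1"]] e2 by simp
    moreover have "(hardy_norm (\<lambda>z. \<Sum>n<N. y n z))\<^sup>2 \<le> (C * hardy_norm (\<lambda>z. \<Sum>n<N. e n z))\<^sup>2"
      using C[of "\<lambda>z. \<Sum>n<N. e n z"] sums[of N] hardy2_sum[of "{..<N}" y "\<lambda>_. 1"] y
      by (intro power_mono) (auto intro!: hardy_norm_nonneg)
    ultimately show ?thesis by (simp add: power_mult_distrib)
  qed
  then show thesis using that by blast
qed

text \<open>The squared norm of the sum of the first \<open>N\<close> vectors is the sum of \<open>N\<^sup>2\<close> Gram entries, so it grows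
  quadratically, while for a Riesz sequence it grows at most linearly.\<close>

lemma not_riesz_if_gram_positive:
  assumes y: "\<And>n. y n \<in> hardy2" and c: "0 < c"
    and gram: "\<And>m n. c \<le> Re (hardy_inner (y m) (y n))"
  shows "\<not> riesz_sequence y"
proof
  assume "riesz_sequence y"
  then obtain C where C: "\<And>N. (hardy_norm (\<lambda>z. \<Sum>n<N. y n z))\<^sup>2 \<le> C * real N"
    using riesz_sequence_sum_bound[of y, OF y] by metis
  have lower: "c * (real N)\<^sup>2 \<le> (hardy_norm (\<lambda>z. \<Sum>n<N. y n z))\<^sup>2" for N
  proof -
    have "hardy_inner (\<lambda>z. \<Sum>n<N. 1 * y n z) (\<lambda>z. \<Sum>n<N. 1 * y n z) =
        (\<Sum>i<N. \<Sum>j<N. 1 * cnj 1 * hardy_inner (y i) (y j))"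
      by (rule hardy_inner_sum_sum[OF y])
    then have "(hardy_norm (\<lambda>z. \<Sum>n<N. y n z))\<^sup>2 = (\<Sum>i<N. \<Sum>j<N. Re (hardy_inner (y i) (y j)))"
      using hardy_norm_square[OF hardy2_sum[of "{..<N}" y "\<lambda>_. 1"]] y by simp
    also have "\<dots> \<ge> (\<Sum>i<N. \<Sum>j<N. c)" by (intro sum_mono gram)
    finally show ?thesis by (simp add: power2_eq_square mult_ac)
  qed
  obtain N :: nat where N: "C / c + 1 < real N" using reals_Archimedean2 by blast
  have "c * (real N)\<^sup>2 \<le> C * real N" using lower[of N] C[of N] by simp
  then have "c * real N * real N \<le> C * real N" by (simp add: power2_eq_square mult_ac)
  then have "N = 0 \<or> c * real N \<le> C" by (cases "N = 0") (auto dest: mult_right_le_imp_le)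
  moreover have "C < c * real N" using N c by (simp add: field_simps)
  moreover have "N \<noteq> 0"
    using C[of 1] lower[of 1] c N by (intro notI) (auto simp: field_simps)
  ultimately show False by simp
qed

text \<open>A Gram matrix of this shape arises from \<open>x\<^sub>n = g + y\<^sub>n\<close> with \<open>|g|\<^sup>2 = 1/2\<close>, \<open>u\<^sub>n = \<langle>y\<^sub>n, g\<rangle>\<close> and nearly
  orthogonal \<open>y\<^sub>n\<close>. All its entries have real part at least \<open>1/4\<close>, and this is inherited by
  subsequences.\<close>

lemma UMNR_if_gram_nearly_constant:
  assumes x: "\<And>n. x n \<in> K" "\<And>n. x n \<in> hardy2" "\<And>n. hardy_norm (x n) = 1"
    and u: "\<And>i. cmod (u i) \<le> 1/32 * (1/4) ^ i"
    and off: "\<And>i j. i \<noteq> j \<Longrightarrow>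
      cmod (hardy_inner (x i) (x j) - (1/2 + u i + cnj (u j))) \<le> 1/16 * (1/2) ^ (i + j)"
  shows "UMNR_in K x"
proof -
  have diag: "hardy_inner (x i) (x i) = 1" for i
    using hardy_inner_self(1)[OF x(2)[of i]] x(3) by simp
  have "uniformly_minimal x"
  proof (rule uniformly_minimal_if_gram_bounded_below[of x "1/4"])
    fix M :: "nat set" and d :: "nat \<Rightarrow> complex" assume "finite M"
    from nearly_constant_gram_lower_bound[OF this u, of "\<lambda>i j. hardy_inner (x i) (x j)" d, OF diag off]
    show "1/4 * (\<Sum>i\<in>M. (cmod (d i))\<^sup>2) \<le> (hardy_norm (\<lambda>z. \<Sum>i\<in>M. d i * x i z))\<^sup>2"
      using hardy_inner_sum_sum[of M x d] x(2) hardy_norm_square[OF hardy2_sum[of M x d]] by simp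
  qed (use x in auto)
  moreover have "\<not> riesz_sequence (x \<circ> \<rho>)" if "strict_mono \<rho>" for \<rho> :: "nat \<Rightarrow> nat"
  proof (rule not_riesz_if_gram_positive[of _ "1/4"])
    have re: "1/4 \<le> Re (hardy_inner (x i) (x j))" for i j
    proof (cases "i = j")
      case False
      define E where "E = hardy_inner (x i) (x j) - (1/2 + u i + cnj (u j))"
      have small: "\<bar>Re (u k)\<bar> \<le> 1/32" for k
        using u[of k] abs_Re_le_cmod[of "u k"] power_le_one[of "1/4 :: real" k] by simp
      have "\<bar>Re E\<bar> \<le> 1/16"
        using off[OF False] abs_Re_le_cmod[of E] power_le_one[of "1/2 :: real" "i + j"]
        unfolding E_def by linarith
      moreover have "Re (hardy_inner (x i) (x j)) = 1/2 + Re (u i) + Re (u j) + Re E"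
        by (simp add: E_def)
      ultimately show ?thesis using small[of i] small[of j] by linarith
    qed (simp add: diag)
    then show "1/4 \<le> Re (hardy_inner ((x \<circ> \<rho>) m) ((x \<circ> \<rho>) n))" for m n by simp
  qed (use x in auto)
  ultimately show ?thesis using x by (auto simp: UMNR_in_def)
qed

section \<open>Bounded kernel norms along the radius to an Ahern--Clark point\<close>

lemma blaschke_factor_defect:
  assumes a: "a \<in> ball 0 1" and z: "z \<in> ball 0 1"
  shows "1 - (cmod (blaschke_factor a z))\<^sup>2 =
      (1 - (cmod a)\<^sup>2) * (1 - (cmod z)\<^sup>2) / (cmod (1 - cnj a * z))\<^sup>2"
proof (cases "a = 0")
  case False
  have nz: "cmod (1 - cnj a * z) \<noteq> 0" using norm_one_minus_cnj_mult_ge(2)[OF a z] by simp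
  have "(cmod (1 - cnj a * z))\<^sup>2 - (cmod (a - z))\<^sup>2 = (1 - (cmod a)\<^sup>2) * (1 - (cmod z)\<^sup>2)"
    unfolding cmod_power2 by (simp add: power2_eq_square algebra_simps)
  moreover have "cmod (blaschke_factor a z) = cmod (a - z) / cmod (1 - cnj a * z)"
    using False by (simp add: blaschke_factor_def norm_mult norm_divide)
  then have "1 - (cmod (blaschke_factor a z))\<^sup>2 =
      ((cmod (1 - cnj a * z))\<^sup>2 - (cmod (a - z))\<^sup>2) / (cmod (1 - cnj a * z))\<^sup>2"
    using nz by (simp add: power_divide diff_divide_distrib)
  ultimately show ?thesis by (simp only:)
qed (simp add: blaschke_factor_def)

lemma blaschke_factor_le_one:
  assumes "a \<in> ball 0 1" "z \<in> ball 0 1"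
  shows "cmod (blaschke_factor a z) \<le> 1"
proof -
  have "0 \<le> 1 - (cmod (blaschke_factor a z))\<^sup>2"
    unfolding blaschke_factor_defect[OF assms] using assms
    by (intro divide_nonneg_nonneg mult_nonneg_nonneg) (auto simp: abs_square_le_1)
  then show ?thesis by (simp add: abs_square_le_1)
qed

lemma one_minus_prod_power_le:
  fixes x :: "'a \<Rightarrow> real" and n :: "'a \<Rightarrow> nat"
  assumes "finite F" "\<And>a. a \<in> F \<Longrightarrow> 0 \<le> x a \<and> x a \<le> 1"
  shows "1 - (\<Prod>a\<in>F. x a ^ n a) \<le> (\<Sum>a\<in>F. real (n a) * (1 - x a))"
  using assms
proof (induction F)
  case (insert a F)
  define y p where "y = x a ^ n a" and "p = (\<Prod>a\<in>F. x a ^ n a)"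
  have y: "0 \<le> y" "y \<le> 1" using insert.prems[of a] by (auto simp: y_def power_le_one)
  have p: "p \<le> 1" unfolding p_def using insert.prems by (intro prod_le_1) (auto simp: power_le_one)
  have "1 + real (n a) * (x a - 1) \<le> (1 + (x a - 1)) ^ n a"
    using insert.prems[of a] by (intro Bernoulli_inequality) auto
  then have "1 - y \<le> real (n a) * (1 - x a)" by (simp add: y_def algebra_simps)
  moreover have "1 - y * p \<le> (1 - y) + (1 - p)"
  proof -
    have "0 \<le> (1 - y) * (1 - p)" using y p by simp
    then show ?thesis by (simp add: algebra_simps)
  qed
  moreover have "1 - p \<le> (\<Sum>a\<in>F. real (n a) * (1 - x a))"
    unfolding p_def using insert by auto
  ultimately show ?case using insert.hyps by (simp add: y_def p_def)
qed simp

text \<open>\<open>|\<zeta> - a| = |1 - cnj a * \<zeta>|\<close>, and replacing \<open>\<zeta>\<close> by \<open>r * \<zeta>\<close> costs at most \<open>(1 - r) * |a| \<le> 1 - r * |a|\<close>,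
  which is itself a lower bound for \<open>|1 - cnj a * (r * \<zeta>)|\<close>.\<close>

lemma dist_boundary_point_le:
  assumes \<zeta>: "cmod \<zeta> = 1" and a: "cmod a \<le> 1" and r: "0 \<le> r" "r < 1"
  shows "cmod (\<zeta> - a) \<le> 2 * cmod (1 - cnj a * (of_real r * \<zeta>))"
proof -
  have "\<zeta> * cnj \<zeta> = 1" using \<zeta> by (simp add: complex_norm_square[symmetric])
  then have "1 - cnj a * \<zeta> = \<zeta> * cnj (\<zeta> - a)" by (simp add: algebra_simps)
  then have "cmod (\<zeta> - a) = cmod (1 - cnj a * \<zeta>)"
    using \<zeta> by (simp only: norm_mult complex_mod_cnj mult_1)
  also have "1 - cnj a * \<zeta> = (1 - cnj a * (of_real r * \<zeta>)) - of_real (1 - r) * (cnj a * \<zeta>)"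
    by (simp add: algebra_simps)
  also have "cmod \<dots> \<le> cmod (1 - cnj a * (of_real r * \<zeta>)) + (1 - r) * cmod a"
    using norm_triangle_ineq4[of "1 - cnj a * (of_real r * \<zeta>)" "of_real (1 - r) * (cnj a * \<zeta>)"] \<zeta> r
    by (simp add: norm_mult del: of_real_diff)
  also have "(1 - r) * cmod a \<le> 1 - r * cmod a"
    using a by (simp add: algebra_simps)
  also have "1 - r * cmod a \<le> cmod (1 - cnj a * (of_real r * \<zeta>))"
    using norm_triangle_ineq2[of 1 "cnj a * (of_real r * \<zeta>)"] \<zeta> r by (simp add: norm_mult mult_ac)
  finally show ?thesis by simp
qed

lemma finite_sum_le_nn_integral_count_space:
  assumes "finite F" "F \<subseteq> A"
  shows "(\<Sum>a\<in>F. f a) \<le> (\<integral>\<^sup>+ a. f a \<partial>count_space A)"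
proof -
  have "(\<integral>\<^sup>+ a. f a * indicator F a \<partial>count_space A) = (\<Sum>a\<in>F. f a * indicator F a)"
    using assms by (intro nn_integral_count_space') auto
  moreover have "(\<integral>\<^sup>+ a. f a * indicator F a \<partial>count_space A) \<le> (\<integral>\<^sup>+ a. f a \<partial>count_space A)"
    by (intro nn_integral_mono) (auto split: split_indicator)
  moreover have "(\<Sum>a\<in>F. f a * indicator F a) = (\<Sum>a\<in>F. f a)"
    by (intro sum.cong) auto
  ultimately show ?thesis by simp
qed

text \<open>\<open>1 - \<Prod>x\<^sub>a \<le> \<Sum>(1 - x\<^sub>a)\<close> for numbers in the unit interval, and for \<open>x\<^sub>a\<close> the squared modulus of a
  Blaschke factor at \<open>r * \<zeta>\<close> each defect is at most \<open>4 * (1 - r\<^sup>2)\<close> times the Ahern--Clark summand.\<close>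

lemma blaschke_product_defect_le:
  assumes \<zeta>: "cmod \<zeta> = 1" and r: "0 \<le> r" "r < 1" and Z: "Z \<subseteq> ball 0 1"
    and fin: "(\<integral>\<^sup>+ a. ennreal (of_int (n a) * ((1 - (cmod a)\<^sup>2) / (cmod (\<zeta> - a))\<^sup>2)) \<partial>count_space Z) < \<infinity>"
      (is "?S < \<infinity>")
    and lim: "((\<lambda>F. \<Prod>a\<in>F. blaschke_factor a (of_real r * \<zeta>) ^ nat (n a)) \<longlongrightarrow> B) (finite_subsets_at_top Z)"
  shows "cmod B \<le> 1" "1 - (cmod B)\<^sup>2 \<le> 4 * (1 - r\<^sup>2) * enn2real ?S"
proof -
  define z where "z = of_real r * \<zeta>"
  have z: "z \<in> ball 0 1" "cmod z = r" using \<zeta> r by (auto simp: z_def norm_mult)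
  define t where "t = (\<lambda>a. (1 - (cmod a)\<^sup>2) / (cmod (\<zeta> - a))\<^sup>2)"
  have r2: "0 \<le> 1 - r\<^sup>2" using r by (simp add: power_le_one)
  have defect: "1 - (cmod (blaschke_factor a z))\<^sup>2 \<le> 4 * (1 - r\<^sup>2) * t a" if "a \<in> Z" for a
  proof -
    have a: "a \<in> ball 0 1" using that Z by auto
    then have za: "0 < cmod (\<zeta> - a)" using \<zeta> by auto
    have a2: "0 \<le> 1 - (cmod a)\<^sup>2" using a by (simp add: power_le_one)
    have "(cmod (\<zeta> - a))\<^sup>2 \<le> (2 * cmod (1 - cnj a * z))\<^sup>2"
      using dist_boundary_point_le[OF \<zeta> _ r, of a] a unfolding z_def by (intro power_mono) auto
    then have "(cmod (\<zeta> - a))\<^sup>2 \<le> 4 * (cmod (1 - cnj a * z))\<^sup>2" by (simp add: power_mult_distrib)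
    moreover have "0 < (cmod (\<zeta> - a))\<^sup>2" "0 < (cmod (1 - cnj a * z))\<^sup>2"
      using za norm_one_minus_cnj_mult_ge(2)[OF a z(1)] by auto
    ultimately have "1 / (cmod (1 - cnj a * z))\<^sup>2 \<le> 4 / (cmod (\<zeta> - a))\<^sup>2"
      by (simp add: field_simps)
    from mult_left_mono[OF this mult_nonneg_nonneg[OF a2 r2]]
    show ?thesis unfolding blaschke_factor_defect[OF a z(1)] z(2) t_def
      by (simp only: times_divide_eq_right times_divide_eq_left mult_1_right mult_ac)
  qed
  have t0: "0 \<le> t a" if "a \<in> Z" for a
    using that Z unfolding t_def by (intro divide_nonneg_nonneg) (auto simp: abs_square_le_1)
  have le1: "cmod (blaschke_factor a z) \<le> 1" if "a \<in> Z" for a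
    using that Z by (intro blaschke_factor_le_one z(1)) auto
  have partial: "cmod (\<Prod>a\<in>F. blaschke_factor a z ^ nat (n a)) \<le> 1 \<and>
      1 - (cmod (\<Prod>a\<in>F. blaschke_factor a z ^ nat (n a)))\<^sup>2 \<le> 4 * (1 - r\<^sup>2) * enn2real ?S"
    if F: "finite F" "F \<subseteq> Z" for F
  proof
    show "cmod (\<Prod>a\<in>F. blaschke_factor a z ^ nat (n a)) \<le> 1"
      unfolding prod_norm[symmetric] norm_power using F le1
      by (intro prod_le_1) (auto intro!: power_le_one)
    have "(cmod (\<Prod>a\<in>F. blaschke_factor a z ^ nat (n a)))\<^sup>2 = (\<Prod>a\<in>F. ((cmod (blaschke_factor a z))\<^sup>2) ^ nat (n a))"
      unfolding prod_norm[symmetric] norm_power prod_power_distrib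
      by (intro prod.cong refl) (simp add: mult.commute flip: power_mult)
    then have "1 - (cmod (\<Prod>a\<in>F. blaschke_factor a z ^ nat (n a)))\<^sup>2 \<le>
        (\<Sum>a\<in>F. real (nat (n a)) * (1 - (cmod (blaschke_factor a z))\<^sup>2))"
      using F le1 by (simp only:) (intro one_minus_prod_power_le; force intro: power_le_one)
    also have "\<dots> \<le> (\<Sum>a\<in>F. 4 * (1 - r\<^sup>2) * (real (nat (n a)) * t a))"
    proof (rule sum_mono)
      fix a assume "a \<in> F"
      then have "real (nat (n a)) * (1 - (cmod (blaschke_factor a z))\<^sup>2) \<le> real (nat (n a)) * (4 * (1 - r\<^sup>2) * t a)"
        using F by (intro mult_left_mono defect) auto
      then show "real (nat (n a)) * (1 - (cmod (blaschke_factor a z))\<^sup>2) \<le> 4 * (1 - r\<^sup>2) * (real (nat (n a)) * t a)"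
        by (simp add: mult_ac)
    qed
    also have "\<dots> = 4 * (1 - r\<^sup>2) * (\<Sum>a\<in>F. real (nat (n a)) * t a)"
      by (simp add: sum_distrib_left)
    also have "\<dots> \<le> 4 * (1 - r\<^sup>2) * enn2real ?S"
    proof (rule mult_left_mono)
      have "ennreal (\<Sum>a\<in>F. real (nat (n a)) * t a) = (\<Sum>a\<in>F. ennreal (real (nat (n a)) * t a))"
        using F t0 by (subst sum_ennreal) auto
      also have "\<dots> = (\<Sum>a\<in>F. ennreal (of_int (n a) * t a))"
      proof (rule sum.cong[OF refl])
        fix a assume "a \<in> F"
        then show "ennreal (real (nat (n a)) * t a) = ennreal (of_int (n a) * t a)"
          using t0[of a] F by (cases "0 \<le> n a") (auto simp: ennreal_neg mult_nonpos_nonneg)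
      qed
      also have "\<dots> \<le> ?S"
        unfolding t_def using F by (rule finite_sum_le_nn_integral_count_space)
      finally have "ennreal (\<Sum>a\<in>F. real (nat (n a)) * t a) \<le> ?S" .
      from enn2real_mono[OF this] show "(\<Sum>a\<in>F. real (nat (n a)) * t a) \<le> enn2real ?S"
        using fin F t0 sum_nonneg[of F "\<lambda>a. real (nat (n a)) * t a"] by (simp add: subset_iff)
    qed (use r2 in simp)
    finally show "1 - (cmod (\<Prod>a\<in>F. blaschke_factor a z ^ nat (n a)))\<^sup>2 \<le> 4 * (1 - r\<^sup>2) * enn2real ?S" .
  qed
  have lim': "((\<lambda>F. \<Prod>a\<in>F. blaschke_factor a z ^ nat (n a)) \<longlongrightarrow> B) (finite_subsets_at_top Z)"
    using lim by (simp add: z_def)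
  show "cmod B \<le> 1"
    by (rule tendsto_upperbound[OF tendsto_norm[OF lim']])
      (simp_all only: eventually_finite_subsets_at_top_weakI partial finite_subsets_at_top_neq_bot not_False_eq_True)
  show "1 - (cmod B)\<^sup>2 \<le> 4 * (1 - r\<^sup>2) * enn2real ?S"
    by (rule tendsto_upperbound[OF tendsto_diff[OF tendsto_const tendsto_power[OF tendsto_norm[OF lim']]]])
      (simp_all only: eventually_finite_subsets_at_top_weakI partial finite_subsets_at_top_neq_bot not_False_eq_True)
qed

text \<open>The real part of the integrand is the Poisson kernel \<open>(1 - r\<^sup>2) / |\<xi> - r * \<zeta>|\<^sup>2\<close>, and
  \<open>|\<zeta> - \<xi>| \<le> 2 * |\<xi> - r * \<zeta>|\<close>.\<close>

lemma poisson_integral_le: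
  assumes \<zeta>: "cmod \<zeta> = 1" and r: "0 \<le> r" "r < 1"
    and \<nu>: "sets \<nu> = sets borel" "finite_measure \<nu>" "emeasure \<nu> (- sphere 0 1) = 0"
    and fin: "(\<integral>\<^sup>+ \<xi>. 1 / ennreal ((cmod (\<zeta> - \<xi>))\<^sup>2) \<partial>\<nu>) < \<infinity>" (is "?S < \<infinity>")
  shows "Re (LINT \<xi>|\<nu>. (\<xi> + of_real r * \<zeta>) / (\<xi> - of_real r * \<zeta>)) \<le> 4 * (1 - r\<^sup>2) * enn2real ?S"
proof -
  define z where "z = of_real r * \<zeta>"
  have z: "cmod z = r" using \<zeta> r by (auto simp: z_def norm_mult)
  have r2: "0 \<le> 1 - r\<^sup>2" using r by (simp add: power_le_one)
  have AE: "AE \<xi> in \<nu>. cmod \<xi> = 1"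
    by (rule AE_I[of _ _ "- sphere 0 1"]) (use \<nu> in \<open>auto simp: sets_eq_imp_space_eq[OF \<nu>(1)]\<close>)
  have mz [measurable]: "(\<lambda>\<xi>. (\<xi> + z) / (\<xi> - z)) \<in> borel_measurable \<nu>"
    using \<nu>(1) by (simp cong: measurable_cong_sets)
  have int: "integrable \<nu> (\<lambda>\<xi>. (\<xi> + z) / (\<xi> - z))"
  proof (rule finite_measure.integrable_const_bound[OF \<nu>(2) _ mz])
    show "AE \<xi> in \<nu>. cmod ((\<xi> + z) / (\<xi> - z)) \<le> 2 / (1 - r)"
      using AE
    proof eventually_elim
      case (elim \<xi>)
      have "1 - r \<le> cmod (\<xi> - z)" using norm_triangle_ineq2[of \<xi> z] elim z by simp
      moreover have "cmod (\<xi> + z) \<le> 2" using norm_triangle_ineq[of \<xi> z] elim z r by simp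
      ultimately show ?case using r unfolding norm_divide by (intro frac_le) auto
    qed
  qed
  have re: "Re ((\<xi> + z) / (\<xi> - z)) = (1 - r\<^sup>2) / (cmod (\<xi> - z))\<^sup>2" if "cmod \<xi> = 1" for \<xi>
  proof -
    have "Re ((\<xi> + z) / (\<xi> - z)) = ((cmod \<xi>)\<^sup>2 - (cmod z)\<^sup>2) / (cmod (\<xi> - z))\<^sup>2"
      unfolding Re_divide cmod_power2 add_divide_distrib[symmetric]
      by (rule arg_cong2[of _ _ _ _ "(/)"]) (simp_all add: power2_eq_square algebra_simps)
    then show ?thesis using that z by simp
  qed
  have "Re (LINT \<xi>|\<nu>. (\<xi> + z) / (\<xi> - z)) = (LINT \<xi>|\<nu>. Re ((\<xi> + z) / (\<xi> - z)))"
    using int by simp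
  also have "\<dots> = enn2real (\<integral>\<^sup>+ \<xi>. ennreal (Re ((\<xi> + z) / (\<xi> - z))) \<partial>\<nu>)"
  proof (rule integral_eq_nn_integral)
    show "AE \<xi> in \<nu>. 0 \<le> Re ((\<xi> + z) / (\<xi> - z))"
      using AE by eventually_elim (use r2 in \<open>auto simp: re intro!: divide_nonneg_nonneg\<close>)
    show "(\<lambda>\<xi>. Re ((\<xi> + z) / (\<xi> - z))) \<in> borel_measurable \<nu>"
      by (rule borel_measurable_continuous_on[OF _ mz]) (intro continuous_intros)
  qed
  also have "\<dots> \<le> enn2real (\<integral>\<^sup>+ \<xi>. ennreal (4 * (1 - r\<^sup>2)) * (1 / ennreal ((cmod (\<zeta> - \<xi>))\<^sup>2)) \<partial>\<nu>)"
  proof (rule enn2real_mono)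
    show "(\<integral>\<^sup>+ \<xi>. ennreal (Re ((\<xi> + z) / (\<xi> - z))) \<partial>\<nu>) \<le>
        (\<integral>\<^sup>+ \<xi>. ennreal (4 * (1 - r\<^sup>2)) * (1 / ennreal ((cmod (\<zeta> - \<xi>))\<^sup>2)) \<partial>\<nu>)"
    proof (rule nn_integral_mono_AE, use AE in eventually_elim)
      case (elim \<xi>)
      show ?case
      proof (cases "\<xi> = \<zeta>")
        case True
        have "0 < 1 - r\<^sup>2" using r by (simp add: power_less_one_iff abs_square_less_1)
        then show ?thesis using True by (simp add: ennreal_mult_top ennreal_divide_zero)
      next
        case False
        have p: "0 < (cmod (\<zeta> - \<xi>))\<^sup>2" using False by simp
        have "\<xi> * cnj \<xi> = 1" using elim by (simp add: complex_norm_square[symmetric])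
        then have "\<xi> - z = \<xi> * (1 - cnj \<xi> * z)" by (simp add: algebra_simps)
        then have "cmod (\<xi> - z) = cmod (1 - cnj \<xi> * z)" using elim by (simp add: norm_mult)
        then have "cmod (\<zeta> - \<xi>) \<le> 2 * cmod (\<xi> - z)"
          using dist_boundary_point_le[OF \<zeta> _ r, of \<xi>] elim by (simp add: z_def)
        then have "(cmod (\<zeta> - \<xi>))\<^sup>2 \<le> (2 * cmod (\<xi> - z))\<^sup>2" by (intro power_mono) auto
        then have le: "(cmod (\<zeta> - \<xi>))\<^sup>2 \<le> 4 * (cmod (\<xi> - z))\<^sup>2" by (simp add: power_mult_distrib)
        then have "0 < (cmod (\<xi> - z))\<^sup>2" using p by linarith
        then have "1 / (cmod (\<xi> - z))\<^sup>2 \<le> 4 / (cmod (\<zeta> - \<xi>))\<^sup>2"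
          using le p by (simp add: field_simps)
        from mult_left_mono[OF this r2]
        have "Re ((\<xi> + z) / (\<xi> - z)) \<le> 4 * (1 - r\<^sup>2) * (1 / (cmod (\<zeta> - \<xi>))\<^sup>2)"
          using re[OF elim] by (simp add: mult_ac)
        then have "ennreal (Re ((\<xi> + z) / (\<xi> - z))) \<le> ennreal (4 * (1 - r\<^sup>2) * (1 / (cmod (\<zeta> - \<xi>))\<^sup>2))"
          by (rule ennreal_leI)
        also have "\<dots> = ennreal (4 * (1 - r\<^sup>2)) * (1 / ennreal ((cmod (\<zeta> - \<xi>))\<^sup>2))"
          using r2 p divide_ennreal[of 1 "(cmod (\<zeta> - \<xi>))\<^sup>2"] by (subst ennreal_mult) auto
        finally show ?thesis .
      qed
    qed
    have "(\<integral>\<^sup>+ \<xi>. ennreal (4 * (1 - r\<^sup>2)) * (1 / ennreal ((cmod (\<zeta> - \<xi>))\<^sup>2)) \<partial>\<nu>) = ennreal (4 * (1 - r\<^sup>2)) * ?S"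
      using \<nu>(1) by (intro nn_integral_cmult) (simp cong: measurable_cong_sets)
    then show "(\<integral>\<^sup>+ \<xi>. ennreal (4 * (1 - r\<^sup>2)) * (1 / ennreal ((cmod (\<zeta> - \<xi>))\<^sup>2)) \<partial>\<nu>) < top"
      using fin by (simp add: ennreal_mult_less_top)
  qed
  also have "\<dots> = 4 * (1 - r\<^sup>2) * enn2real ?S"
    using \<nu>(1) r2 by (subst nn_integral_cmult) (simp_all add: enn2real_mult cong: measurable_cong_sets)
  finally show ?thesis by (simp add: z_def)
qed

text \<open>For \<open>\<theta>\<close> with Blaschke factor \<open>B\<close> and singular factor \<open>S\<close>, the defect \<open>1 - |\<theta>|\<^sup>2\<close> is at most
  \<open>(1 - |B|\<^sup>2) + (1 - |S|\<^sup>2)\<close>, and both terms are of order \<open>1 - r\<^sup>2\<close>.\<close>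

lemma ahern_clark_radial_bound:
  assumes "\<zeta> \<in> ahern_clark \<theta>"
  obtains C where "\<And>r. 0 \<le> r \<Longrightarrow> r < 1 \<Longrightarrow> kernel_square \<theta> (of_real r * \<zeta>) \<le> C"
proof -
  let ?S1 = "\<integral>\<^sup>+ a. ennreal (of_int (zorder \<theta> a) * ((1 - (cmod a)\<^sup>2) / (cmod (\<zeta> - a))\<^sup>2)) \<partial>count_space (disc_zeros \<theta>)"
  from assms obtain \<nu> where \<zeta>: "cmod \<zeta> = 1" and gen: "generates_singular_factor \<theta> \<nu>"
    and fin: "?S1 + (\<integral>\<^sup>+ \<xi>. 1 / ennreal ((cmod (\<zeta> - \<xi>))\<^sup>2) \<partial>\<nu>) < \<infinity>"
    unfolding ahern_clark_def by auto
  let ?S2 = "\<integral>\<^sup>+ \<xi>. 1 / ennreal ((cmod (\<zeta> - \<xi>))\<^sup>2) \<partial>\<nu>"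
  from fin have fin1: "?S1 < \<infinity>" and fin2: "?S2 < \<infinity>" by (auto simp: less_top)
  from gen obtain c B where c: "cmod c = 1"
    and lim: "\<And>z. z \<in> ball 0 1 \<Longrightarrow> ((\<lambda>F. \<Prod>a\<in>F. blaschke_factor a z ^ nat (zorder \<theta> a)) \<longlongrightarrow> B z)
             (finite_subsets_at_top (disc_zeros \<theta>))"
    and fact: "\<And>z. z \<in> ball 0 1 \<Longrightarrow> \<theta> z = c * B z * exp (- (LINT \<xi>|\<nu>. (\<xi> + z) / (\<xi> - z)))"
    and \<nu>: "sets \<nu> = sets borel" "finite_measure \<nu>" "emeasure \<nu> (- sphere 0 1) = 0"
    unfolding generates_singular_factor_def by blast
  have "kernel_square \<theta> (of_real r * \<zeta>) \<le> 4 * enn2real ?S1 + 8 * enn2real ?S2" if r: "0 \<le> r" "r < 1" for r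
  proof -
    define z where "z = of_real r * \<zeta>"
    have z: "z \<in> ball 0 1" "cmod z = r" using \<zeta> r by (auto simp: z_def norm_mult)
    define I where "I = Re (LINT \<xi>|\<nu>. (\<xi> + z) / (\<xi> - z))"
    have r2: "0 < 1 - r\<^sup>2" using r by (simp add: abs_square_less_1)
    have "disc_zeros \<theta> \<subseteq> ball 0 1" by (auto simp: disc_zeros_def)
    note B = blaschke_product_defect_le[OF \<zeta> r this fin1 lim[OF z(1), unfolded z_def], folded z_def]
    have I: "I \<le> 4 * (1 - r\<^sup>2) * enn2real ?S2"
      unfolding I_def z_def by (rule poisson_integral_le[OF \<zeta> r \<nu> fin2])
    have "(cmod (\<theta> z))\<^sup>2 = (cmod (B z))\<^sup>2 * exp (- (2 * I))"
      unfolding fact[OF z(1)]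
      by (simp add: norm_mult c power_mult_distrib I_def power2_eq_square flip: exp_add)
    then have "1 - (cmod (\<theta> z))\<^sup>2 = (1 - (cmod (B z))\<^sup>2) + (cmod (B z))\<^sup>2 * (1 - exp (- (2 * I)))"
      by (simp add: algebra_simps)
    also have "(cmod (B z))\<^sup>2 * (1 - exp (- (2 * I))) \<le> (cmod (B z))\<^sup>2 * (8 * (1 - r\<^sup>2) * enn2real ?S2)"
    proof (rule mult_left_mono)
      have "2 * I \<le> 8 * (1 - r\<^sup>2) * enn2real ?S2" using I by (simp add: algebra_simps)
      then show "1 - exp (- (2 * I)) \<le> 8 * (1 - r\<^sup>2) * enn2real ?S2"
        using exp_ge_add_one_self[of "- (2 * I)"] by linarith
    qed simp
    also have "\<dots> \<le> 1 * (8 * (1 - r\<^sup>2) * enn2real ?S2)"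
      using B(1) r2 by (intro mult_right_mono) (auto simp: power_le_one)
    finally have "1 - (cmod (\<theta> z))\<^sup>2 \<le> (4 * enn2real ?S1 + 8 * enn2real ?S2) * (1 - r\<^sup>2)"
      using B(2) by (simp add: algebra_simps)
    then show ?thesis
      using r2 z(2) unfolding kernel_square_def z_def[symmetric] by (simp add: pos_divide_le_eq)
  qed
  then show thesis using that by blast
qed

section \<open>The kernels near the boundary point\<close>

text \<open>A greedy choice: the next index is taken so large that all rows up to the current index are within
  tolerance of their limits. Requiring this of all these rows, and not just of the rows selected so
  far, makes the condition depend on the current index alone.\<close>

lemma subsequence_for_iterated_limit:
  fixes a :: "nat \<Rightarrow> nat \<Rightarrow> 'a::metric_space"
  assumes a: "\<And>m. (\<lambda>n. a m n) \<longlonglongrightarrow> g m" and g: "g \<longlonglongrightarrow> l" and e: "\<And>k. 0 < e k"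
  obtains \<sigma> :: "nat \<Rightarrow> nat" where "strict_mono \<sigma>" "\<And>k. dist (g (\<sigma> k)) l < e k"
    "\<And>j k. j < k \<Longrightarrow> dist (a (\<sigma> j) (\<sigma> k)) (g (\<sigma> j)) < e k"
proof -
  have "\<exists>\<sigma>. \<forall>k. dist (g (\<sigma> k)) l < e k \<and>
      (\<sigma> k < \<sigma> (Suc k) \<and> (\<forall>j\<le>\<sigma> k. dist (a j (\<sigma> (Suc k))) (g j) < e (Suc k)))"
  proof (rule dependent_nat_choice[where P = "\<lambda>k s. dist (g s) l < e k" and
        Q = "\<lambda>k s s'. s < s' \<and> (\<forall>j\<le>s. dist (a j s') (g j) < e (Suc k))"])
    show "\<exists>s. dist (g s) l < e 0"
      using tendstoD[OF g e[of 0]] eventually_happens' by force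
  next
    fix s k
    have "\<forall>\<^sub>F n in sequentially. \<forall>j\<in>{..s}. dist (a j n) (g j) < e (Suc k)"
      by (rule eventually_ball_finite) (auto intro: tendstoD[OF a e])
    moreover have "\<forall>\<^sub>F n in sequentially. dist (g n) l < e (Suc k)"
      by (rule tendstoD[OF g e])
    moreover have "\<forall>\<^sub>F n in sequentially. s < n" by (rule eventually_gt_at_top)
    ultimately have "\<forall>\<^sub>F n in sequentially. dist (g n) l < e (Suc k) \<and> s < n \<and>
        (\<forall>j\<le>s. dist (a j n) (g j) < e (Suc k))"
      by eventually_elim auto
    then show "\<exists>s'. dist (g s') l < e (Suc k) \<and> s < s' \<and> (\<forall>j\<le>s. dist (a j s') (g j) < e (Suc k))"
      using eventually_happens' sequentially_bot by blast
  qed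
  then obtain \<sigma> where \<sigma>: "\<And>k. dist (g (\<sigma> k)) l < e k" "\<And>k. \<sigma> k < \<sigma> (Suc k)"
    "\<And>k j. j \<le> \<sigma> k \<Longrightarrow> dist (a j (\<sigma> (Suc k))) (g j) < e (Suc k)" by blast
  have mono: "strict_mono \<sigma>" using \<sigma>(2) by (simp add: strict_mono_Suc_iff)
  show thesis
  proof (rule that[OF mono \<sigma>(1)])
    fix j k :: nat assume "j < k"
    then obtain k' where k': "k = Suc k'" "j \<le> k'" by (cases k) auto
    then show "dist (a (\<sigma> j) (\<sigma> k)) (g (\<sigma> j)) < e k"
      using \<sigma>(3)[of "\<sigma> j" k'] mono by (simp add: strict_mono_less_eq)
  qed
qed

lemma spectrum_small_values:
  assumes "\<zeta> \<in> boundary_spectrum \<theta>" and \<epsilon>: "0 < \<epsilon>"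
  obtains w where "w \<in> ball 0 1" "dist w \<zeta> < \<epsilon>" "cmod (\<theta> w) < 1/2"
proof -
  have L: "Liminf (at \<zeta> within ball 0 1) (\<lambda>z. ereal (cmod (\<theta> z))) = 0"
    using assms by (simp add: boundary_spectrum_def)
  have "\<not> (\<forall>w\<in>ball 0 1. dist w \<zeta> < \<epsilon> \<longrightarrow> 1/2 \<le> cmod (\<theta> w))"
  proof
    assume *: "\<forall>w\<in>ball 0 1. dist w \<zeta> < \<epsilon> \<longrightarrow> 1/2 \<le> cmod (\<theta> w)"
    have "\<forall>\<^sub>F w in at \<zeta> within ball 0 1. ereal (1/2) \<le> ereal (cmod (\<theta> w))"
      unfolding eventually_at using * \<epsilon> by auto
    then have "ereal (1/2) \<le> Liminf (at \<zeta> within ball 0 1) (\<lambda>z. ereal (cmod (\<theta> z)))"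
      by (rule Liminf_bounded)
    then show False unfolding L by simp
  qed
  then show thesis using that by (auto simp: not_le)
qed

lemma kernel_square_nonneg:
  assumes "inner_function \<theta>" "w \<in> ball 0 1"
  shows "0 \<le> kernel_square \<theta> w"
  unfolding model_kernel_norm_square[OF assms, symmetric] by simp

lemma kernel_square_continuous:
  assumes "inner_function \<theta>"
  shows "continuous_on (ball 0 1) (kernel_square \<theta>)"
proof -
  have "continuous_on (ball 0 1) \<theta>"
    using assms by (auto simp: inner_function_def intro: holomorphic_on_imp_continuous_on)
  moreover have "1 - (cmod w)\<^sup>2 \<noteq> 0" if "w \<in> ball 0 1" for w :: complex
    using that abs_square_less_1[of "cmod w"] by simp
  ultimately show ?thesis
    unfolding kernel_square_def by (intro continuous_intros) auto
qed

lemma one_minus_theta_square: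
  assumes "w \<in> ball 0 1"
  shows "1 - (cmod (\<theta> w))\<^sup>2 = kernel_square \<theta> w * (1 - (cmod w)\<^sup>2)"
  using assms abs_square_less_1[of "cmod w"] by (simp add: kernel_square_def)

lemma model_kernel_Cauchy_Schwarz:
  assumes \<theta>: "inner_function \<theta>" and v: "v \<in> ball 0 1" and w: "w \<in> ball 0 1"
  shows "(cmod (model_kernel \<theta> v w))\<^sup>2 \<le> kernel_square \<theta> v * kernel_square \<theta> w"
proof -
  have "(cmod (model_kernel \<theta> v w))\<^sup>2 \<le> (hardy_norm (model_kernel \<theta> v) * hardy_norm (model_kernel \<theta> w))\<^sup>2"
    unfolding model_kernel_gram[OF \<theta> v w, symmetric]
    by (intro power_mono hardy_Cauchy_Schwarz model_kernel_hardy2 \<theta> v w norm_ge_zero)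
  then show ?thesis
    by (simp only: power_mult_distrib model_kernel_norm_square[OF \<theta> v] model_kernel_norm_square[OF \<theta> w])
qed

text \<open>The first factor on the right is the squared norm of the difference of the kernels at \<open>v\<close> and \<open>v'\<close>.\<close>

lemma model_kernel_diff_Cauchy_Schwarz:
  assumes \<theta>: "inner_function \<theta>" and v: "v \<in> ball 0 1" and v': "v' \<in> ball 0 1" and w: "w \<in> ball 0 1"
  shows "(cmod (model_kernel \<theta> v w - model_kernel \<theta> v' w))\<^sup>2 \<le>
    (kernel_square \<theta> v + kernel_square \<theta> v' - 2 * Re (model_kernel \<theta> v v')) * kernel_square \<theta> w"
proof -
  let ?d = "\<lambda>z. model_kernel \<theta> v z + (-1) * model_kernel \<theta> v' z"
  note kv = model_kernel_hardy2[OF \<theta> v] and kv' = model_kernel_hardy2[OF \<theta> v'] and kw = model_kernel_hardy2[OF \<theta> w]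
  have d: "?d \<in> hardy2" by (rule hardy2_add_scaled[OF kv kv'])
  have "hardy_inner ?d (model_kernel \<theta> w) = model_kernel \<theta> v w - model_kernel \<theta> v' w"
    unfolding hardy_inner_add_scaled[OF kv kv' kw] model_kernel_gram[OF \<theta> v w] model_kernel_gram[OF \<theta> v' w]
    by simp
  then have "cmod (model_kernel \<theta> v w - model_kernel \<theta> v' w) \<le> hardy_norm ?d * hardy_norm (model_kernel \<theta> w)"
    using hardy_Cauchy_Schwarz[OF d kw] by simp
  then have "(cmod (model_kernel \<theta> v w - model_kernel \<theta> v' w))\<^sup>2 \<le> (hardy_norm ?d * hardy_norm (model_kernel \<theta> w))\<^sup>2"
    by (rule power_mono) simp
  moreover have "(hardy_norm ?d)\<^sup>2 = kernel_square \<theta> v + kernel_square \<theta> v' - 2 * Re (model_kernel \<theta> v v')"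
    unfolding hardy_norm_add_scaled_square[OF kv kv'] model_kernel_gram[OF \<theta> v v']
      model_kernel_norm_square[OF \<theta> v] model_kernel_norm_square[OF \<theta> v'] by simp
  ultimately show ?thesis
    by (simp only: power_mult_distrib model_kernel_norm_square[OF \<theta> w])
qed

text \<open>The kernel at a boundary point with boundary value \<open>\<beta>\<close> of \<open>\<theta>\<close>.\<close>

definition boundary_kernel :: "(complex \<Rightarrow> complex) \<Rightarrow> complex \<Rightarrow> complex \<Rightarrow> complex \<Rightarrow> complex" where
  "boundary_kernel \<theta> \<zeta> \<beta> w = (1 - cnj \<beta> * \<theta> w) / (1 - cnj \<zeta> * w)"

lemma one_minus_cnj_boundary_nonzero:
  assumes "cmod \<zeta> = 1" "w \<in> ball 0 1"
  shows "1 - cnj \<zeta> * w \<noteq> 0"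
proof
  assume "1 - cnj \<zeta> * w = 0"
  then have "cmod (cnj \<zeta> * w) = 1" by simp
  then show False using assms by (simp add: norm_mult)
qed

lemma model_kernel_tendsto_boundary_kernel:
  assumes \<zeta>: "cmod \<zeta> = 1" and w: "w \<in> ball 0 1" and v: "v \<longlonglongrightarrow> \<zeta>" "(\<lambda>n. \<theta> (v n)) \<longlonglongrightarrow> \<beta>"
    and vb: "\<And>n. v n \<in> ball 0 1"
  shows "(\<lambda>n. model_kernel \<theta> (v n) w) \<longlonglongrightarrow> boundary_kernel \<theta> \<zeta> \<beta> w"
    and "(\<lambda>n. model_kernel \<theta> w (v n)) \<longlonglongrightarrow> cnj (boundary_kernel \<theta> \<zeta> \<beta> w)"
proof -
  have 1: "(\<lambda>n. (1 - cnj (\<theta> (v n)) * \<theta> w) / (1 - cnj (v n) * w)) \<longlonglongrightarrow> boundary_kernel \<theta> \<zeta> \<beta> w"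
    unfolding boundary_kernel_def
    by (intro tendsto_intros v one_minus_cnj_boundary_nonzero[OF \<zeta> w])
  then show "(\<lambda>n. model_kernel \<theta> (v n) w) \<longlonglongrightarrow> boundary_kernel \<theta> \<zeta> \<beta> w"
    using w by (simp add: model_kernel_def)
  have "model_kernel \<theta> w (v n) = cnj ((1 - cnj (\<theta> (v n)) * \<theta> w) / (1 - cnj (v n) * w))" for n
    using vb[of n] by (simp add: model_kernel_def mult.commute)
  then show "(\<lambda>n. model_kernel \<theta> w (v n)) \<longlonglongrightarrow> cnj (boundary_kernel \<theta> \<zeta> \<beta> w)"
    using tendsto_cnj[OF 1] by simp
qed

text \<open>Points \<open>\<mu>\<^sub>j = r\<^sub>j * \<zeta>\<close> on the radius to \<open>\<zeta>\<close> along which both \<open>\<theta>\<close> and the squared kernel norm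
  converge. They serve as test points for all other approaches to \<open>\<zeta>\<close>.\<close>

locale boundary_approach =
  fixes \<theta> :: "complex \<Rightarrow> complex" and \<zeta> \<beta> :: complex and L :: real and r :: "nat \<Rightarrow> real"
  assumes \<theta>: "inner_function \<theta>" and \<zeta>: "cmod \<zeta> = 1"
    and r: "\<And>j. 0 \<le> r j" "\<And>j. r j < 1" "r \<longlonglongrightarrow> 1"
    and \<beta>: "(\<lambda>j. \<theta> (of_real (r j) * \<zeta>)) \<longlonglongrightarrow> \<beta>"
    and L: "(\<lambda>j. kernel_square \<theta> (of_real (r j) * \<zeta>)) \<longlonglongrightarrow> L"
begin

abbreviation \<mu> where "\<mu> j \<equiv> of_real (r j) * \<zeta>"
abbreviation h where "h \<equiv> boundary_kernel \<theta> \<zeta> \<beta>"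
abbreviation q where "q \<equiv> kernel_square \<theta>"

lemma \<mu>_in: "\<mu> j \<in> ball 0 1"
  using \<zeta> r(1,2)[of j] by (simp add: norm_mult)

lemma norm_\<mu>: "cmod (\<mu> j) = r j"
  using \<zeta> r(1)[of j] by (simp add: norm_mult)

lemma \<mu>_tendsto: "\<mu> \<longlonglongrightarrow> \<zeta>"
  by (rule tendsto_eq_intros r(3) refl | simp)+

lemma L_nonneg: "0 \<le> L"
  using L by (rule LIMSEQ_le_const) (auto intro!: kernel_square_nonneg \<theta> \<mu>_in)

lemma norm_\<beta>: "cmod \<beta> = 1"
proof -
  have "(\<lambda>j. q (\<mu> j) * (1 - (r j)\<^sup>2)) \<longlonglongrightarrow> L * (1 - 1\<^sup>2)"
    by (intro tendsto_intros L r(3))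
  moreover have "q (\<mu> j) * (1 - (r j)\<^sup>2) = 1 - (cmod (\<theta> (\<mu> j)))\<^sup>2" for j
    using one_minus_theta_square[OF \<mu>_in[of j], of \<theta>] norm_\<mu> by simp
  moreover have "(\<lambda>j. 1 - (cmod (\<theta> (\<mu> j)))\<^sup>2) \<longlonglongrightarrow> 1 - (cmod \<beta>)\<^sup>2"
    by (intro tendsto_intros \<beta>)
  ultimately have "1 - (cmod \<beta>)\<^sup>2 = 0"
    using LIMSEQ_unique by force
  then show ?thesis by (simp add: power2_eq_1_iff) (use norm_ge_zero[of \<beta>] in linarith)
qed

lemma cnj_\<beta>_\<beta>: "cnj \<beta> * \<beta> = 1"
  using norm_\<beta> by (simp add: mult.commute complex_norm_square[symmetric])

text \<open>Julia's inequality, the limit of the Cauchy--Schwarz inequality for the kernels at \<open>\<mu>\<^sub>j\<close> and \<open>w\<close>.\<close>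

lemma boundary_kernel_bound:
  assumes w: "w \<in> ball 0 1"
  shows "(cmod (h w))\<^sup>2 \<le> L * q w"
proof (rule LIMSEQ_le)
  show "(\<lambda>j. (cmod (model_kernel \<theta> (\<mu> j) w))\<^sup>2) \<longlonglongrightarrow> (cmod (h w))\<^sup>2"
    by (intro tendsto_intros model_kernel_tendsto_boundary_kernel(1)[OF \<zeta> w \<mu>_tendsto \<beta> \<mu>_in])
  show "(\<lambda>j. q (\<mu> j) * q w) \<longlonglongrightarrow> L * q w" by (intro tendsto_intros L)
qed (auto intro!: model_kernel_Cauchy_Schwarz[OF \<theta> \<mu>_in w])

text \<open>Julia's inequality gives \<open>|h (\<mu>\<^sub>i)|\<^sup>2 \<le> L * q (\<mu>\<^sub>i) \<rightarrow> L\<^sup>2\<close>. In the other direction,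
  \<open>Re (h (\<mu>\<^sub>i)) \<ge> (1 - |\<theta> (\<mu>\<^sub>i)|) / (1 - r\<^sub>i)\<close>, which is \<open>q (\<mu>\<^sub>i)\<close> up to a factor tending to \<open>1\<close>. A number
  of modulus about \<open>L\<close> whose real part is at least about \<open>L\<close> is close to \<open>L\<close>.\<close>

lemma boundary_kernel_radial_limit: "(\<lambda>i. h (\<mu> i)) \<longlonglongrightarrow> of_real L"
proof -
  define b where "b = (\<lambda>i. q (\<mu> i) * ((1 + r i) / (1 + cmod (\<theta> (\<mu> i)))))"
  have "b \<longlonglongrightarrow> L * ((1 + 1) / (1 + cmod \<beta>))"
    unfolding b_def using norm_\<beta> by (intro tendsto_intros L r(3) \<beta>) auto
  then have b: "b \<longlonglongrightarrow> L" using norm_\<beta> by simp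
  have re: "b i \<le> Re (h (\<mu> i))" for i
  proof -
    have r1: "0 < 1 - r i" "0 \<le> r i" using r(1,2)[of i] by auto
    have "cnj \<zeta> * \<mu> i = of_real (r i)"
      using \<zeta> by (simp add: mult.left_commute mult.commute complex_norm_square[symmetric])
    then have "h (\<mu> i) = (1 - cnj \<beta> * \<theta> (\<mu> i)) / of_real (1 - r i)"
      by (simp add: boundary_kernel_def)
    then have "Re (h (\<mu> i)) = (1 - Re (cnj \<beta> * \<theta> (\<mu> i))) / (1 - r i)"
      by (simp del: of_real_diff add: Re_divide_of_real)
    moreover have "Re (cnj \<beta> * \<theta> (\<mu> i)) \<le> cmod (\<theta> (\<mu> i))"
      using complex_Re_le_cmod[of "cnj \<beta> * \<theta> (\<mu> i)"] norm_\<beta> by (simp add: norm_mult)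
    ultimately have "(1 - cmod (\<theta> (\<mu> i))) / (1 - r i) \<le> Re (h (\<mu> i))"
      using r1 by (simp add: divide_right_mono)
    moreover have "(1 - cmod (\<theta> (\<mu> i))) / (1 - r i) = b i"
    proof -
      have pos: "0 < 1 + cmod (\<theta> (\<mu> i))" by (simp add: add_pos_nonneg)
      have "q (\<mu> i) = (1 - cmod (\<theta> (\<mu> i))) * (1 + cmod (\<theta> (\<mu> i))) / ((1 - r i) * (1 + r i))"
        unfolding kernel_square_def norm_\<mu> by (simp add: power2_eq_square algebra_simps)
      then show ?thesis using pos r1 unfolding b_def by simp
    qed
    ultimately show ?thesis by simp
  qed
  have bound: "(cmod (h (\<mu> i) - of_real L))\<^sup>2 \<le> L * q (\<mu> i) - 2 * L * b i + L\<^sup>2" for i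
  proof -
    have "(cmod (h (\<mu> i) - of_real L))\<^sup>2 = (cmod (h (\<mu> i)))\<^sup>2 - 2 * L * Re (h (\<mu> i)) + L\<^sup>2"
      unfolding cmod_power2 by (simp add: power2_eq_square algebra_simps)
    also have "\<dots> \<le> L * q (\<mu> i) - 2 * L * b i + L\<^sup>2"
      using boundary_kernel_bound[OF \<mu>_in[of i]] mult_left_mono[OF re[of i] L_nonneg] by simp
    finally show ?thesis .
  qed
  have "(\<lambda>i. L * q (\<mu> i) - 2 * L * b i + L\<^sup>2) \<longlonglongrightarrow> L * L - 2 * L * L + L\<^sup>2"
    by (intro tendsto_intros L b)
  then have "(\<lambda>i. L * q (\<mu> i) - 2 * L * b i + L\<^sup>2) \<longlonglongrightarrow> 0" by (simp add: power2_eq_square)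
  then have "(\<lambda>i. (cmod (h (\<mu> i) - of_real L))\<^sup>2) \<longlonglongrightarrow> 0"
    by (rule tendsto_sandwich[rotated 3, where f = "\<lambda>_. 0"]) (auto intro!: always_eventually bound)
  then have "(\<lambda>i. sqrt ((cmod (h (\<mu> i) - of_real L))\<^sup>2)) \<longlonglongrightarrow> sqrt 0"
    by (rule tendsto_real_sqrt)
  then have "(\<lambda>i. h (\<mu> i) - of_real L) \<longlonglongrightarrow> 0" by (simp add: tendsto_norm_zero_iff)
  then show ?thesis by (rule LIM_zero_cancel)
qed

text \<open>The first factor on the right tends to zero with growing \<open>i\<close>: the kernels at \<open>\<mu>\<^sub>i\<close> converge in norm to
  the boundary kernel.\<close>

lemma boundary_kernel_approx:
  assumes w: "w \<in> ball 0 1"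
  shows "(cmod (h w - model_kernel \<theta> (\<mu> i) w))\<^sup>2 \<le> (L + q (\<mu> i) - 2 * Re (h (\<mu> i))) * q w"
proof (rule LIMSEQ_le)
  show "(\<lambda>j. (cmod (model_kernel \<theta> (\<mu> j) w - model_kernel \<theta> (\<mu> i) w))\<^sup>2) \<longlonglongrightarrow>
      (cmod (h w - model_kernel \<theta> (\<mu> i) w))\<^sup>2"
    by (intro tendsto_intros model_kernel_tendsto_boundary_kernel(1)[OF \<zeta> w \<mu>_tendsto \<beta> \<mu>_in])
  show "(\<lambda>j. (q (\<mu> j) + q (\<mu> i) - 2 * Re (model_kernel \<theta> (\<mu> j) (\<mu> i))) * q w) \<longlonglongrightarrow>
      (L + q (\<mu> i) - 2 * Re (h (\<mu> i))) * q w"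
    by (intro tendsto_intros L model_kernel_tendsto_boundary_kernel(1)[OF \<zeta> \<mu>_in \<mu>_tendsto \<beta> \<mu>_in])
qed (auto intro!: model_kernel_diff_Cauchy_Schwarz[OF \<theta> \<mu>_in \<mu>_in w])

text \<open>Bounded kernel norms bound \<open>h\<close> by Julia's inequality, and the denominator of \<open>h\<close> tends to zero.\<close>

lemma theta_tendsto_\<beta>:
  assumes w: "\<And>n. w n \<in> ball 0 1" "w \<longlonglongrightarrow> \<zeta>" and Q: "\<And>n. q (w n) \<le> Q"
  shows "(\<lambda>n. \<theta> (w n)) \<longlonglongrightarrow> \<beta>"
proof -
  have bound: "cmod (1 - cnj \<beta> * \<theta> (w n)) \<le> sqrt (L * Q) * cmod (1 - cnj \<zeta> * w n)" for n
  proof -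
    have "(cmod (h (w n)))\<^sup>2 \<le> L * Q"
      using boundary_kernel_bound[OF w(1)[of n]] mult_left_mono[OF Q[of n] L_nonneg] by linarith
    then have "cmod (h (w n)) \<le> sqrt (L * Q)" by (rule real_le_rsqrt)
    then have "cmod (h (w n)) * cmod (1 - cnj \<zeta> * w n) \<le> sqrt (L * Q) * cmod (1 - cnj \<zeta> * w n)"
      by (rule mult_right_mono) simp
    then show ?thesis
      using one_minus_cnj_boundary_nonzero[OF \<zeta> w(1)[of n]] by (simp add: boundary_kernel_def norm_divide)
  qed
  have "cnj \<zeta> * \<zeta> = 1" using \<zeta> by (simp add: mult.commute complex_norm_square[symmetric])
  then have "(\<lambda>n. sqrt (L * Q) * cmod (1 - cnj \<zeta> * w n)) \<longlonglongrightarrow> 0"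
    by (auto intro!: tendsto_eq_intros w(2))
  then have "(\<lambda>n. 1 - cnj \<beta> * \<theta> (w n)) \<longlonglongrightarrow> 0"
    by (rule Lim_null_comparison[rotated]) (use bound in auto)
  then have "(\<lambda>n. \<beta> - \<beta> * (1 - cnj \<beta> * \<theta> (w n))) \<longlonglongrightarrow> \<beta> - \<beta> * 0"
    by (intro tendsto_intros)
  moreover have "\<beta> - \<beta> * (1 - cnj \<beta> * \<theta> (w n)) = cnj \<beta> * \<beta> * \<theta> (w n)" for n
    by (simp add: algebra_simps)
  ultimately show ?thesis by (simp add: cnj_\<beta>_\<beta>)
qed

text \<open>Weak convergence of the kernels at \<open>w\<^sub>n\<close>, tested against \<open>h\<close>. As \<open>h\<close> is approximated in norm by the
  kernel at some \<open>\<mu>\<^sub>i\<close>, it suffices to test against that kernel, where the limit is \<open>cnj (h (\<mu>\<^sub>i))\<close>; this is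
  close to \<open>L\<close> by the radial limit.\<close>

lemma boundary_kernel_limit:
  assumes w: "\<And>n. w n \<in> ball 0 1" "w \<longlonglongrightarrow> \<zeta>" and Q: "\<And>n. q (w n) \<le> Q"
  shows "(\<lambda>n. h (w n)) \<longlonglongrightarrow> of_real L"
proof (rule tendstoI)
  fix e :: real assume e: "0 < e"
  have Q0: "0 \<le> Q" using Q[of 0] kernel_square_nonneg[OF \<theta> w(1)[of 0]] by simp
  define \<delta> where "\<delta> = (\<lambda>i. L + q (\<mu> i) - 2 * Re (h (\<mu> i)))"
  have "(\<lambda>i. sqrt (\<bar>\<delta> i\<bar> * Q)) \<longlonglongrightarrow> sqrt (\<bar>L + L - 2 * Re (of_real L)\<bar> * Q)"
    unfolding \<delta>_def by (intro tendsto_intros L boundary_kernel_radial_limit)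
  then have "(\<lambda>i. sqrt (\<bar>\<delta> i\<bar> * Q)) \<longlonglongrightarrow> 0" by simp
  then have "\<forall>\<^sub>F i in sequentially. sqrt (\<bar>\<delta> i\<bar> * Q) < e/3"
    using e by (intro order_tendstoD(2)) auto
  moreover have "\<forall>\<^sub>F i in sequentially. dist (h (\<mu> i)) (of_real L) < e/3"
    using e by (intro tendstoD[OF boundary_kernel_radial_limit]) auto
  ultimately have "\<forall>\<^sub>F i in sequentially. sqrt (\<bar>\<delta> i\<bar> * Q) < e/3 \<and> dist (h (\<mu> i)) (of_real L) < e/3"
    by (rule eventually_conj)
  then obtain i where i: "sqrt (\<bar>\<delta> i\<bar> * Q) < e/3" "dist (h (\<mu> i)) (of_real L) < e/3"
    using eventually_happens' sequentially_bot by blast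
  have i2: "dist (cnj (h (\<mu> i))) (of_real L) < e/3"
    using i(2) by (metis complex_cnj_complex_of_real complex_cnj_diff complex_mod_cnj dist_norm)
  have "\<forall>\<^sub>F n in sequentially. dist (model_kernel \<theta> (\<mu> i) (w n)) (cnj (h (\<mu> i))) < e/3"
    using e by (intro tendstoD[OF model_kernel_tendsto_boundary_kernel(2)
      [OF \<zeta> \<mu>_in w(2) theta_tendsto_\<beta>[OF w Q] w(1)]]) auto
  then show "\<forall>\<^sub>F n in sequentially. dist (h (w n)) (of_real L) < e"
  proof eventually_elim
    case (elim n)
    have "(cmod (h (w n) - model_kernel \<theta> (\<mu> i) (w n)))\<^sup>2 \<le> \<bar>\<delta> i\<bar> * Q"
      using boundary_kernel_approx[OF w(1)[of n], of i] mult_mono[OF abs_ge_self[of "\<delta> i"] Q[of n]]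
        kernel_square_nonneg[OF \<theta> w(1)[of n]]
      unfolding \<delta>_def by simp
    then have "cmod (h (w n) - model_kernel \<theta> (\<mu> i) (w n)) \<le> sqrt (\<bar>\<delta> i\<bar> * Q)" by (rule real_le_rsqrt)
    then have "dist (h (w n)) (model_kernel \<theta> (\<mu> i) (w n)) < e/3" using i(1) by (simp add: dist_norm)
    then show ?case
      using elim i2 dist_triangle[of "h (w n)" "of_real L" "model_kernel \<theta> (\<mu> i) (w n)"]
        dist_triangle[of "model_kernel \<theta> (\<mu> i) (w n)" "of_real L" "cnj (h (\<mu> i))"] by linarith
  qed
qed

text \<open>For \<open>L = 0\<close>, Julia's inequality would force \<open>h = 0\<close>, so that \<open>\<theta>\<close> would be the constant \<open>\<beta>\<close>.\<close>

lemma L_pos: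
  assumes w: "w \<in> ball 0 1" "cmod (\<theta> w) < 1"
  shows "0 < L"
proof (rule ccontr)
  assume "\<not> 0 < L"
  then have "L = 0" using L_nonneg by simp
  then have "h w = 0" using boundary_kernel_bound[OF w(1)] by simp
  then have "cnj \<beta> * \<theta> w = 1"
    using one_minus_cnj_boundary_nonzero[OF \<zeta> w(1)] by (simp add: boundary_kernel_def)
  then have "cmod (cnj \<beta> * \<theta> w) = 1" by simp
  then show False using w(2) norm_\<beta> by (simp add: norm_mult)
qed

text \<open>Near \<open>\<zeta>\<close> there are radial points where \<open>q\<close> is close to \<open>L\<close> and points where \<open>\<theta>\<close> is small and \<open>q\<close> is
  therefore large; the intersection of the disc with a small ball around \<open>\<zeta>\<close> is connected.\<close>

lemma kernel_square_takes_value: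
  assumes small: "\<And>\<epsilon>. 0 < \<epsilon> \<Longrightarrow> \<exists>w\<in>ball 0 1. dist w \<zeta> < \<epsilon> \<and> cmod (\<theta> w) < 1/2"
    and Q: "L < Q" and \<epsilon>: "0 < \<epsilon>"
  shows "\<exists>w\<in>ball 0 1. dist w \<zeta> < \<epsilon> \<and> q w = Q"
proof -
  have Q0: "0 < Q" using Q L_nonneg by simp
  \<comment> \<open>If \<open>|\<theta> s| < 1/2\<close> and \<open>1 - |s| \<le> 3 / (8 * Q)\<close>, then \<open>q s \<ge> (3/4) / (3 / (4 * Q)) = Q\<close>.\<close>
  define \<epsilon>' where "\<epsilon>' = min \<epsilon> (3 / (8 * Q))"
  have \<epsilon>': "0 < \<epsilon>'" "\<epsilon>' \<le> \<epsilon>" "\<epsilon>' \<le> 3 / (8 * Q)" using \<epsilon> Q0 by (auto simp: \<epsilon>'_def)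
  define U where "U = ball \<zeta> \<epsilon>' \<inter> ball 0 1"
  have "\<forall>\<^sub>F j in sequentially. q (\<mu> j) < Q \<and> dist (\<mu> j) \<zeta> < \<epsilon>'"
    using order_tendstoD(2)[OF L Q] tendstoD[OF \<mu>_tendsto \<epsilon>'(1)] by (rule eventually_conj)
  then obtain j where j: "q (\<mu> j) < Q" "dist (\<mu> j) \<zeta> < \<epsilon>'"
    using eventually_happens' sequentially_bot by blast
  have jU: "\<mu> j \<in> U" using j(2) \<mu>_in by (simp add: U_def dist_commute)
  obtain s where s: "s \<in> ball 0 1" "dist s \<zeta> < \<epsilon>'" "cmod (\<theta> s) < 1/2"
    using small[OF \<epsilon>'(1)] by blast
  have sU: "s \<in> U" using s by (simp add: U_def dist_commute)
  have "Q \<le> q s"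
  proof -
    have s1: "cmod s < 1" using s(1) by simp
    have "1 - cmod s \<le> dist s \<zeta>" using norm_triangle_ineq2[of \<zeta> s] \<zeta> by (simp add: dist_norm norm_minus_commute)
    then have "1 - cmod s < 3 / (8 * Q)" using s(2) \<epsilon>'(3) by linarith
    moreover have "1 - (cmod s)\<^sup>2 \<le> 2 * (1 - cmod s)"
      using zero_le_power2[of "1 - cmod s"] by (simp add: power2_eq_square algebra_simps)
    ultimately have "1 - (cmod s)\<^sup>2 \<le> 2 * (3 / (8 * Q))"
      using order_trans[OF _ mult_left_mono[of "1 - cmod s" "3 / (8 * Q)" 2]] by simp
    then have "Q * (1 - (cmod s)\<^sup>2) \<le> Q * (2 * (3 / (8 * Q)))" using Q0 by (intro mult_left_mono) auto
    then have "Q * (1 - (cmod s)\<^sup>2) \<le> 3/4" using Q0 by simp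
    moreover have "(cmod (\<theta> s))\<^sup>2 \<le> (1/2)\<^sup>2" using s(3) by (intro power_mono) auto
    moreover have "0 < 1 - (cmod s)\<^sup>2" using s1 by (simp add: abs_square_less_1)
    ultimately show ?thesis
      unfolding kernel_square_def by (simp add: pos_le_divide_eq power2_eq_square)
  qed
  have "connected (q ` U)"
    unfolding U_def
    by (intro connected_continuous_image continuous_on_subset[OF kernel_square_continuous[OF \<theta>]]
        convex_connected convex_Int convex_ball) auto
  then have "Q \<in> q ` U"
    by (rule connectedD_interval[OF _ imageI[OF jU] imageI[OF sU] less_imp_le[OF j(1)] \<open>Q \<le> q s\<close>])
  then obtain w where "w \<in> U" "q w = Q" by auto
  then show ?thesis using \<epsilon>'(2) by (intro bexI[of _ w]) (auto simp: U_def dist_commute)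
qed

end

section \<open>Uniformly minimal non-Riesz kernel sequences\<close>

text \<open>Both \<open>\<theta>\<close> and the squared kernel norm are bounded on the radius, so a subsequence of any radial
  sequence makes both converge.\<close>

lemma boundary_approach_exists:
  assumes \<theta>: "inner_function \<theta>" and \<zeta>: "cmod \<zeta> = 1"
    and C: "\<And>r. 0 \<le> r \<Longrightarrow> r < 1 \<Longrightarrow> kernel_square \<theta> (of_real r * \<zeta>) \<le> C"
  obtains \<beta> L r where "boundary_approach \<theta> \<zeta> \<beta> L r"
proof -
  define s :: "nat \<Rightarrow> real" where "s = (\<lambda>j. 1 - 1 / real (Suc j))"
  have s: "0 \<le> s j" "s j < 1" for j by (auto simp: s_def divide_simps)
  have s1: "s \<longlonglongrightarrow> 1"
    unfolding s_def using tendsto_diff[OF tendsto_const LIMSEQ_inverse_real_of_nat, of 1]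
    by (simp add: inverse_eq_divide)
  have in_ball: "of_real (s j) * \<zeta> \<in> ball 0 1" for j
    using \<zeta> s[of j] by (simp add: norm_mult)
  define p where "p = (\<lambda>j. (\<theta> (of_real (s j) * \<zeta>), kernel_square \<theta> (of_real (s j) * \<zeta>)))"
  have "p j \<in> cball 0 1 \<times> {0..C}" for j
    using \<theta> in_ball[of j] kernel_square_nonneg[OF \<theta> in_ball[of j]] C[OF s[of j]]
    by (auto simp: p_def inner_function_def)
  moreover have "compact (cball (0 :: complex) 1 \<times> {0..C})"
    by (intro compact_Times compact_cball compact_Icc)
  ultimately obtain l \<rho> where \<rho>: "strict_mono \<rho>" "(p \<circ> \<rho>) \<longlonglongrightarrow> l"
    unfolding compact_def by blast
  have "boundary_approach \<theta> \<zeta> (fst l) (snd l) (s \<circ> \<rho>)"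
  proof
    show "(\<lambda>j. \<theta> (of_real ((s \<circ> \<rho>) j) * \<zeta>)) \<longlonglongrightarrow> fst l"
      using tendsto_fst[OF \<rho>(2)] by (simp add: p_def o_def)
    show "(\<lambda>j. kernel_square \<theta> (of_real ((s \<circ> \<rho>) j) * \<zeta>)) \<longlonglongrightarrow> snd l"
      using tendsto_snd[OF \<rho>(2)] by (simp add: p_def o_def)
  qed (use \<theta> \<zeta> s LIMSEQ_subseq_LIMSEQ[OF s1 \<rho>(1)] in auto)
  then show thesis by (rule that)
qed

text \<open>With the value \<open>2 * L\<close> for the squared norms, the normalized kernels tend weakly to a vector of squared
  norm \<open>1/2\<close>. Any value \<open>Q\<close> above \<open>L\<close> would serve: the limit has squared norm \<open>L / Q\<close>, which has to lie strictly
  between \<open>0\<close> and \<open>1\<close>.\<close>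

lemma kernel_sequence_with_iterated_limit:
  assumes \<theta>: "inner_function \<theta>" and \<zeta>: "\<zeta> \<in> ahern_clark \<theta> \<inter> boundary_spectrum \<theta>"
  obtains w g L where "0 < L" "\<And>n. w n \<in> ball 0 1" "w \<longlonglongrightarrow> \<zeta>" "\<And>n. kernel_square \<theta> (w n) = 2 * L"
    "\<And>m. (\<lambda>n. model_kernel \<theta> (w m) (w n)) \<longlonglongrightarrow> g m" "g \<longlonglongrightarrow> of_real L"
proof -
  have norm_\<zeta>: "cmod \<zeta> = 1" using \<zeta> by (simp add: boundary_spectrum_def)
  have small: "\<exists>w\<in>ball 0 1. dist w \<zeta> < \<epsilon> \<and> cmod (\<theta> w) < 1/2" if "0 < \<epsilon>" for \<epsilon>
    using spectrum_small_values[of \<zeta> \<theta> \<epsilon>] \<zeta> that by blast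
  obtain C where "\<And>r. 0 \<le> r \<Longrightarrow> r < 1 \<Longrightarrow> kernel_square \<theta> (of_real r * \<zeta>) \<le> C"
    using ahern_clark_radial_bound \<zeta> by blast
  then obtain \<beta> L r where "boundary_approach \<theta> \<zeta> \<beta> L r"
    using boundary_approach_exists[OF \<theta> norm_\<zeta>] by blast
  then interpret boundary_approach \<theta> \<zeta> \<beta> L r .
  obtain v where "v \<in> ball 0 1" "cmod (\<theta> v) < 1/2" using small[of 1] by auto
  then have L0: "0 < L" using L_pos[of v] by simp
  have "\<exists>w. w \<in> ball 0 1 \<and> dist w \<zeta> < 1 / real (Suc n) \<and> q w = 2 * L" for n
    using kernel_square_takes_value[OF small, of "2 * L" "1 / real (Suc n)"] L0 by auto
  then obtain w where w: "\<And>n. w n \<in> ball 0 1" "\<And>n. dist (w n) \<zeta> < 1 / real (Suc n)" "\<And>n. q (w n) = 2 * L"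
    by metis
  have lim: "w \<longlonglongrightarrow> \<zeta>"
  proof (rule metric_tendsto_imp_tendsto)
    show "(\<lambda>n. 1 / real (Suc n)) \<longlonglongrightarrow> 0"
      using LIMSEQ_inverse_real_of_nat by (simp add: inverse_eq_divide)
    show "\<forall>\<^sub>F n in sequentially. dist (w n) \<zeta> \<le> dist (1 / real (Suc n)) 0"
      using w(2) by (intro always_eventually allI) (simp add: less_imp_le)
  qed
  have le: "q (w n) \<le> 2 * L" for n using w(3) by simp
  show thesis
  proof (rule that[OF L0 w(1) lim w(3)])
    show "(\<lambda>n. model_kernel \<theta> (w m) (w n)) \<longlonglongrightarrow> cnj (h (w m))" for m
      by (rule model_kernel_tendsto_boundary_kernel(2)[OF norm_\<zeta> w(1) lim theta_tendsto_\<beta>[OF w(1) lim le] w(1)])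
    show "(\<lambda>m. cnj (h (w m))) \<longlonglongrightarrow> of_real L"
      using tendsto_cnj[OF boundary_kernel_limit[OF w(1) lim le]] by simp
  qed
qed

lemma hardy_inner_scale:
  assumes "f \<in> hardy2" "g \<in> hardy2"
  shows "hardy_inner (\<lambda>z. c * f z) (\<lambda>z. d * g z) = c * cnj d * hardy_inner f g"
proof -
  have left: "hardy_inner (\<lambda>z. c * f z) g = c * hardy_inner f g" if "f \<in> hardy2" "g \<in> hardy2" for c f g
    using hardy_inner_add_scaled[OF hardy2_zero that, of c] by (simp add: hardy_inner_zero)
  have "hardy_inner (\<lambda>z. c * f z) (\<lambda>z. d * g z) = c * cnj (hardy_inner (\<lambda>z. d * g z) f)"
    using left[of f "\<lambda>z. d * g z" c] hardy_inner_cnj[of "\<lambda>z. d * g z" f] assms by (simp add: hardy2_scale)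
  also have "hardy_inner (\<lambda>z. d * g z) f = d * cnj (hardy_inner f g)"
    using left[of g f d] hardy_inner_cnj[OF assms] assms by simp
  finally show ?thesis by simp
qed

lemma normalized_kernel_gram:
  assumes \<theta>: "inner_function \<theta>" and "v \<in> ball 0 1" "w \<in> ball 0 1"
    and Q: "kernel_square \<theta> v = Q" "kernel_square \<theta> w = Q" "0 < Q"
  shows "hardy_inner (normalized_kernel \<theta> v) (normalized_kernel \<theta> w) = model_kernel \<theta> v w / of_real Q"
proof -
  have norm: "hardy_norm (model_kernel \<theta> u) = sqrt Q" if "u \<in> ball 0 1" "kernel_square \<theta> u = Q" for u
    using model_kernel_norm_square[OF \<theta> that(1)] that
    by (metis hardy_norm_nonneg model_kernel_hardy2[OF \<theta>] real_sqrt_unique)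
  have nk: "normalized_kernel \<theta> u = (\<lambda>z. of_real (1 / sqrt Q) * model_kernel \<theta> u z)"
    if "u \<in> ball 0 1" "kernel_square \<theta> u = Q" for u
    unfolding normalized_kernel_def norm[OF that] by (rule ext) simp
  have "of_real (1 / sqrt Q) * cnj (of_real (1 / sqrt Q)) = complex_of_real (1 / Q)"
    using Q(3) by (simp flip: of_real_mult)
  then show ?thesis
    unfolding nk[OF assms(2) Q(1)] nk[OF assms(3) Q(2)]
      hardy_inner_scale[OF model_kernel_hardy2[OF \<theta> assms(2)] model_kernel_hardy2[OF \<theta> assms(3)]]
      model_kernel_gram[OF \<theta> assms(2,3)]
    by simp
qed

theorem theorem1p8:
  fixes \<theta> :: "complex \<Rightarrow> complex" and \<zeta> :: complex
  assumes "inner_function \<theta>"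
    and "\<zeta> \<in> ahern_clark \<theta> \<inter> boundary_spectrum \<theta>"
  shows "\<exists>w :: nat \<Rightarrow> complex.
    (\<forall>n. w n \<in> ball 0 1) \<and> w \<longlonglongrightarrow> \<zeta> \<and>
    UMNR_in (model_space \<theta>) (\<lambda>n. normalized_kernel \<theta> (w n))"
proof -
  note \<theta> = assms(1)
  obtain w g L where L: "0 < L" and w: "\<And>n. w n \<in> ball 0 1" "w \<longlonglongrightarrow> \<zeta>"
    and Q: "\<And>n. kernel_square \<theta> (w n) = 2 * L"
    and k: "\<And>m. (\<lambda>n. model_kernel \<theta> (w m) (w n)) \<longlonglongrightarrow> g m" and g: "g \<longlonglongrightarrow> of_real L"
    by (rule kernel_sequence_with_iterated_limit[OF assms]) iprover
  define G where "G = (\<lambda>m n. model_kernel \<theta> (w m) (w n) / of_real (2 * L))"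
  define e :: "nat \<Rightarrow> real" where "e = (\<lambda>k. 1/32 * (1/4) ^ k)"
  have G_lim: "(\<lambda>n. G m n) \<longlonglongrightarrow> g m / of_real (2 * L)" for m
    unfolding G_def using L by (intro tendsto_intros k) auto
  have "(\<lambda>m. g m / of_real (2 * L)) \<longlonglongrightarrow> of_real L / of_real (2 * L)"
    using L by (intro tendsto_intros g) auto
  then have g_lim: "(\<lambda>m. g m / of_real (2 * L)) \<longlonglongrightarrow> 1/2" using L by simp
  have e_pos: "0 < e k" for k by (simp add: e_def)
  obtain \<sigma> where \<sigma>: "strict_mono \<sigma>"
    "\<And>k. dist (g (\<sigma> k) / of_real (2 * L)) (1/2) < e k"
    "\<And>j k. j < k \<Longrightarrow> dist (G (\<sigma> j) (\<sigma> k)) (g (\<sigma> j) / of_real (2 * L)) < e k"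
    by (rule subsequence_for_iterated_limit[of G "\<lambda>m. g m / of_real (2 * L)" "1/2" e,
          OF G_lim g_lim e_pos]) iprover
  \<comment> \<open>The deviation from \<open>1/2\<close> of the inner product of \<open>x\<^sub>k\<close> with the weak limit of the sequence.\<close>
  define u where "u = (\<lambda>k. g (\<sigma> k) / of_real (2 * L) - 1/2)"
  define x where "x = (\<lambda>k. normalized_kernel \<theta> (w (\<sigma> k)))"
  have u: "cmod (u k) \<le> e k" for k
    using \<sigma>(2)[of k] by (simp add: u_def dist_norm)
  have gram: "hardy_inner (x i) (x j) = G (\<sigma> i) (\<sigma> j)" for i j
    unfolding x_def G_def using L by (intro normalized_kernel_gram \<theta> w Q) auto
  have scaled: "x k = (\<lambda>z. (1 / of_real (hardy_norm (model_kernel \<theta> (w (\<sigma> k))))) * model_kernel \<theta> (w (\<sigma> k)) z)" for k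
    by (simp add: x_def normalized_kernel_def fun_eq_iff)
  have x: "x k \<in> hardy2" for k
    unfolding scaled by (intro hardy2_scale model_kernel_hardy2 \<theta> w)
  have "UMNR_in (model_space \<theta>) x"
  proof (rule UMNR_if_gram_nearly_constant[of x _ u])
    show "x k \<in> model_space \<theta>" for k
      unfolding scaled by (intro model_space_scale model_kernel_in_model_space \<theta> w)
    show "hardy_norm (x k) = 1" for k
      using gram[of k k] model_kernel_diagonal[OF w(1)[of "\<sigma> k"], of \<theta>] Q[of "\<sigma> k"] L
      by (simp add: hardy_norm_def G_def)
    show "cmod (u k) \<le> 1/32 * (1/4) ^ k" for k using u[of k] by (simp add: e_def)
    have upper: "cmod (hardy_inner (x i) (x j) - (1/2 + u i + cnj (u j))) \<le> 1/16 * (1/2) ^ (i + j)"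
      if "i < j" for i j
    proof -
      have "hardy_inner (x i) (x j) - (1/2 + u i + cnj (u j)) =
          (G (\<sigma> i) (\<sigma> j) - g (\<sigma> i) / of_real (2 * L)) - cnj (u j)"
        by (simp add: gram u_def)
      also have "cmod \<dots> \<le> e j + e j"
        using norm_triangle_ineq4[of "G (\<sigma> i) (\<sigma> j) - g (\<sigma> i) / of_real (2 * L)" "cnj (u j)"]
          \<sigma>(3)[OF that] u[of j] by (simp add: dist_norm)
      also have "\<dots> = 1/16 * ((1/2) ^ j * (1/2) ^ j)" by (simp add: e_def flip: power_mult_distrib)
      also have "\<dots> \<le> 1/16 * ((1/2) ^ i * (1/2) ^ j)"
        using that by (intro mult_left_mono mult_right_mono power_decreasing) auto
      finally show ?thesis by (simp only: power_add)
    qed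
    show "cmod (hardy_inner (x i) (x j) - (1/2 + u i + cnj (u j))) \<le> 1/16 * (1/2) ^ (i + j)"
      if "i \<noteq> j" for i j
    proof (cases "i < j")
      case False
      have "hardy_inner (x i) (x j) - (1/2 + u i + cnj (u j)) =
          cnj (hardy_inner (x j) (x i) - (1/2 + u j + cnj (u i)))"
        using hardy_inner_cnj[OF x[of j] x[of i]] by simp
      then have "cmod (hardy_inner (x i) (x j) - (1/2 + u i + cnj (u j))) =
          cmod (hardy_inner (x j) (x i) - (1/2 + u j + cnj (u i)))"
        by (simp only: complex_mod_cnj)
      then show ?thesis using upper[of j i] that False by (simp add: add.commute)
    qed (rule upper)
  qed (rule x)
  moreover have "(\<lambda>k. w (\<sigma> k)) \<longlonglongrightarrow> \<zeta>"
    using LIMSEQ_subseq_LIMSEQ[OF w(2) \<sigma>(1)] by (simp add: o_def)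
  ultimately show ?thesis
    using w(1) unfolding x_def by (intro exI[of _ "\<lambda>k. w (\<sigma> k)"]) auto
qed

end
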